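(* Let $K$ be a field of characteristic zero, $R=K[x,y,z]$, $s\ge 3$, and let $I=(L_1^{a_1},\dots,L_s^{a_s})$, where $L_1,\dots,L_s$ are general linear forms and $a_1,\dots,a_s$ are positive integers. Set $p=\max\{j\mid \sum_{a_i\le j}(j+1-a_i)\le j\}$. Let $L$ be a general linear form. Then the homomorphism $\times L^3:[R/I]_{p-2}\to[R/I]_{p+1}$ has maximal rank (i.e. is injective or surjective).
   Context: A sum over an empty index set is zero. "General" means in a suitable nonempty Zariski open set. *)

theory Defs
  imports Main "HOL-Library.Poly_Mapping" "HOL-Library.Product_Plus"
begin

text \<open>The polynomial ring K[x,y,z]: finitely supported maps from exponent triples
  (i,j,k) (the monomial x^i y^j z^k) to coefficients; multiplication is convolution.\<close>
type_synonym 'a poly3 = "(nat \<times> nat \<times> nat) \<Rightarrow>\<^sub>0 'a"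

definition mdeg :: "nat \<times> nat \<times> nat \<Rightarrow> nat" where
  "mdeg m = fst m + fst (snd m) + snd (snd m)"

text \<open>f is homogeneous of degree d (d an integer; only 0 is homogeneous of negative degree),
  i.e. f lies in the graded piece R_d.\<close>
definition homog :: "int \<Rightarrow> 'a::zero poly3 \<Rightarrow> bool" where
  "homog d f \<longleftrightarrow> (\<forall>m \<in> Poly_Mapping.keys f. int (mdeg m) = d)"

definition lin_form :: "'a::comm_monoid_add \<Rightarrow> 'a \<Rightarrow> 'a \<Rightarrow> 'a poly3" where
  "lin_form c0 c1 c2 = Poly_Mapping.single ((1::nat),(0::nat),(0::nat)) c0 + Poly_Mapping.single ((0::nat),(1::nat),(0::nat)) c1
                       + Poly_Mapping.single ((0::nat),(0::nat),(1::nat)) c2"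

definition ideal_gen :: "nat \<Rightarrow> (nat \<Rightarrow> 'a::comm_ring_1 poly3) \<Rightarrow> 'a poly3 set" where
  "ideal_gen s g = {\<Sum>i<s. h i * g i | h. True}"

text \<open>Multiplication by F induces a map [R/I]_d \<rightarrow> [R/I]_(d + deg F); injectivity and
  surjectivity of this induced map on quotients, written out.\<close>
definition mult_inj :: "'a::comm_ring_1 poly3 set \<Rightarrow> 'a poly3 \<Rightarrow> int \<Rightarrow> bool" where
  "mult_inj I F d \<longleftrightarrow> (\<forall>f. homog d f \<longrightarrow> F * f \<in> I \<longrightarrow> f \<in> I)"

definition mult_surj :: "'a::comm_ring_1 poly3 set \<Rightarrow> 'a poly3 \<Rightarrow> int \<Rightarrow> int \<Rightarrow> bool" where
  "mult_surj I F d e \<longleftrightarrow> (\<forall>h. homog e h \<longrightarrow> (\<exists>f. homog d f \<and> h - F * f \<in> I))"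

definition max_rank :: "'a::comm_ring_1 poly3 set \<Rightarrow> 'a poly3 \<Rightarrow> int \<Rightarrow> int \<Rightarrow> bool" where
  "max_rank I F d e \<longleftrightarrow> mult_inj I F d \<or> mult_surj I F d e"

text \<open>Polynomial functions on K^n (points given as nat \<Rightarrow> K, only coordinates < n used).\<close>
inductive polyfun :: "nat \<Rightarrow> ((nat \<Rightarrow> 'a::comm_ring_1) \<Rightarrow> 'a) \<Rightarrow> bool" for n where
  pf_const: "polyfun n (\<lambda>v. c)"
| pf_var: "i < n \<Longrightarrow> polyfun n (\<lambda>v. v i)"
| pf_add: "polyfun n f \<Longrightarrow> polyfun n g \<Longrightarrow> polyfun n (\<lambda>v. f v + g v)"
| pf_mult: "polyfun n f \<Longrightarrow> polyfun n g \<Longrightarrow> polyfun n (\<lambda>v. f v * g v)"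

text \<open>P holds for a general point of K^n: on a nonempty Zariski open set
  (equivalently, on a nonempty basic open set D(g)).\<close>
definition general :: "nat \<Rightarrow> ((nat \<Rightarrow> 'a::comm_ring_1) \<Rightarrow> bool) \<Rightarrow> bool" where
  "general n P \<longleftrightarrow> (\<exists>g. polyfun n g \<and> (\<exists>v. g v \<noteq> 0) \<and> (\<forall>v. g v \<noteq> 0 \<longrightarrow> P v))"

end

theory Submission
  imports Defs "HOL-Computational_Algebra.Polynomial"
begin

text \<open>Put \<open>d = p + 1\<close> and \<open>m\<^sub>i = d + 1 - a\<^sub>i\<close>. Modulo \<open>L\<^sup>3\<close>, maximal rank of \<open>\<times>L\<^sup>3\<close> follows once the
  forms \<open>y\<^sup>b z\<^sup>c L\<^sub>i\<close> to the power \<open>d - b - c\<close> with \<open>c \<le> 2\<close> and \<open>b + c < m\<^sub>i\<close> are independent in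
  \<open>[R/L\<^sup>3]\<^sub>d\<close>, a space of dimension \<open>3 d\<close> (if there are too many of them, some \<open>L\<^sub>i\<close> with
  \<open>m\<^sub>i = 1\<close> are dropped until there are exactly \<open>3 d\<close>, which gives surjectivity). Independence is
  an open condition, so one choice of the forms suffices: \<open>L = z\<close>, \<open>L\<^sub>i = x + t\<^sub>i y + u\<^sub>i z\<close>.
  By apolarity the dual question is whether vanishing to order \<open>m\<^sub>i\<close> at \<open>(t\<^sub>i, u\<^sub>i)\<close> imposes
  independent conditions on the polynomials \<open>F\<^sub>0(t) + F\<^sub>1(t) u + F\<^sub>2(t) u\<^sup>2\<close> with
  \<open>deg F\<^sub>j \<le> d - j\<close>. The definition of \<open>p\<close> gives \<open>\<Sum> (m\<^sub>i - 1) < d\<close>. Distributing the points with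
  \<open>m\<^sub>i \<ge> 2\<close> evenly over the lines \<open>u = 0\<close> and \<open>u = 1\<close> and writing the polynomials as
  \<open>\<alpha> (u - 1)\<^sup>2 + \<beta> u (u - 1) + \<gamma> u\<^sup>2\<close>, the conditions become divisibility conditions on \<open>\<alpha>\<close>, \<open>\<beta>\<close>,
  \<open>\<gamma>\<close>, whose independence is seen from explicit univariate polynomials. Points with
  \<open>m\<^sub>i = 1\<close> are added one at a time, off the zero set of a nonzero polynomial meeting the
  previous conditions.\<close>

subsection \<open>Linear independence of families of vectors\<close>

definition indep_family :: "'j set \<Rightarrow> 'm set \<Rightarrow> ('j \<Rightarrow> 'm \<Rightarrow> 'a::field) \<Rightarrow> bool" where
  "indep_family J M w \<longleftrightarrow>
     (\<forall>k. (\<forall>m\<in>M. (\<Sum>j\<in>J. k j * w j m) = 0) \<longrightarrow> (\<forall>j\<in>J. k j = 0))"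

lemma indep_familyD:
  assumes "indep_family J M w" "\<And>m. m \<in> M \<Longrightarrow> (\<Sum>j\<in>J. k j * w j m) = 0" "j \<in> J"
  shows "k j = 0"
  using assms unfolding indep_family_def by blast

text \<open>Induction on the equations, eliminating one unknown per equation. It serves both to span
  a space by counting and to find a nonzero polynomial subject to fewer linear conditions than it
  has coefficients.\<close>

lemma underdetermined_nontrivial_solution:
  fixes A :: "'e \<Rightarrow> 'x \<Rightarrow> 'a::field"
  assumes "finite E" "finite U" "card E < card U"
  shows "\<exists>F. (\<exists>x\<in>U. F x \<noteq> 0) \<and> (\<forall>e\<in>E. (\<Sum>x\<in>U. A e x * F x) = 0)"
  using assms
proof (induction E arbitrary: U A rule: finite_induct)
  case empty
  then obtain x where "x \<in> U" by fastforce
  then show ?case by (intro exI[of _ "\<lambda>_. 1"]) auto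
next
  case (insert e E)
  show ?case
  proof (cases "\<forall>x\<in>U. A e x = 0")
    case True
    have "card E < card U" using insert by simp
    from insert.IH[OF insert.prems(1) this, of A] obtain F where
      "\<exists>x\<in>U. F x \<noteq> 0" "\<forall>e\<in>E. (\<Sum>x\<in>U. A e x * F x) = 0" by blast
    then show ?thesis using True by (intro exI[of _ F]) auto
  next
    case False
    then obtain x0 where x0: "x0 \<in> U" "A e x0 \<noteq> 0" by blast
    \<comment> \<open>Subtracting a multiple of equation \<open>e\<close> clears the column of
      \<open>x0\<close>; the value at \<open>x0\<close> is then read off from equation
      \<open>e\<close>.\<close>
    define A' where "A' = (\<lambda>e' x. A e' x - A e' x0 / A e x0 * A e x)"
    have "card E < card (U - {x0})" using insert x0 by simp
    from insert.IH[OF _ this, of A'] insert.prems(1) obtain F where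
      F: "\<exists>x\<in>U - {x0}. F x \<noteq> 0" "\<forall>e\<in>E. (\<Sum>x\<in>U - {x0}. A' e x * F x) = 0" by blast
    define F' where "F' = F(x0 := - (\<Sum>x\<in>U - {x0}. A e x * F x) / A e x0)"
    have split: "(\<Sum>x\<in>U. A e' x * F' x) = A e' x0 * F' x0 + (\<Sum>x\<in>U - {x0}. A e' x * F x)" for e'
      using insert.prems(1) x0(1) by (simp add: sum.remove[of U x0] F'_def)
    have "(\<Sum>x\<in>U. A e x * F' x) = 0"
      unfolding split using x0(2) by (simp add: F'_def)
    moreover have "(\<Sum>x\<in>U. A e' x * F' x) = 0" if "e' \<in> E" for e'
    proof -
      have "0 = (\<Sum>x\<in>U - {x0}. A' e' x * F x)" using F(2) that by simp
      also have "\<dots> = (\<Sum>x\<in>U - {x0}. A e' x * F x) - A e' x0 / A e x0 * (\<Sum>x\<in>U - {x0}. A e x * F x)"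
        by (simp add: A'_def sum_subtractf[symmetric] sum_distrib_left algebra_simps)
      finally show ?thesis unfolding split by (simp add: F'_def)
    qed
    moreover have "\<exists>x\<in>U. F' x \<noteq> 0" using F(1) by (auto simp: F'_def)
    ultimately show ?thesis by (intro exI[of _ F']) auto
  qed
qed

text \<open>Adjoining \<open>h\<close> as one more column leaves more unknowns than equations; in a
  nontrivial relation the coefficient of \<open>h\<close> cannot vanish, by independence.\<close>

lemma indep_family_spans:
  assumes "indep_family J M w" "finite J" "finite M" "card J = card M"
  shows "\<exists>k. \<forall>m\<in>M. (\<Sum>j\<in>J. k j * w j m) = h m"
proof -
  define U where "U = insert None (Some ` J)"
  define A where "A = (\<lambda>m x. case x of None \<Rightarrow> h m | Some j \<Rightarrow> w j m)"
  have "card U = Suc (card J)"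
    using assms(2) unfolding U_def by (subst card_insert_disjoint) (auto simp: card_image)
  then have "card M < card U" using assms(4) by simp
  moreover have "finite U" using assms(2) by (simp add: U_def)
  ultimately obtain F where F: "\<exists>x\<in>U. F x \<noteq> 0" "\<forall>m\<in>M. (\<Sum>x\<in>U. A m x * F x) = 0"
    using underdetermined_nontrivial_solution[OF assms(3), of U A] by blast
  have eq: "(\<Sum>x\<in>U. A m x * F x) = h m * F None + (\<Sum>j\<in>J. F (Some j) * w j m)" for m
    using assms(2) unfolding U_def
    by (subst sum.insert) (auto simp: A_def sum.reindex mult.commute)
  have "F None \<noteq> 0"
  proof
    assume F0: "F None = 0"
    have "F (Some j) = 0" if "j \<in> J" for j
      using indep_familyD[OF assms(1), of "\<lambda>j. F (Some j)"] F(2) that by (simp add: eq F0)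
    then show False using F(1) F0 by (auto simp: U_def)
  qed
  show ?thesis
  proof (intro exI ballI)
    fix m assume "m \<in> M"
    then have "h m * F None + (\<Sum>j\<in>J. F (Some j) * w j m) = 0" using F(2) eq by simp
    then have "(\<Sum>j\<in>J. F (Some j) * w j m) = - (h m * F None)" by (simp add: add_eq_0_iff2)
    then have "- (\<Sum>j\<in>J. F (Some j) * w j m) / F None = h m" using \<open>F None \<noteq> 0\<close> by simp
    then show "(\<Sum>j\<in>J. (- F (Some j) / F None) * w j m) = h m"
      by (simp add: sum_divide_distrib sum_negf)
  qed
qed

section \<open>Polynomial functions and openness of independence\<close>

lemma polyfun_uminus: "polyfun n f \<Longrightarrow> polyfun n (\<lambda>v. - f v)"
  using pf_mult[OF pf_const[of n "-1"]] by fastforce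

lemma polyfun_diff: "polyfun n f \<Longrightarrow> polyfun n g \<Longrightarrow> polyfun n (\<lambda>v. f v - g v)"
  using pf_add[of n f "\<lambda>v. - g v"] polyfun_uminus[of n g] by simp

lemma polyfun_prod: "(\<And>i. i \<in> A \<Longrightarrow> polyfun n (f i)) \<Longrightarrow> polyfun n (\<lambda>v. \<Prod>i\<in>A. f i v)"
  by (induction A rule: infinite_finite_induct) (auto intro: pf_const pf_mult)

text \<open>Gaussian elimination with polynomial entries: the product of the pivots is the
  polynomial whose nonvanishing preserves independence.\<close>
lemma indep_family_open:
  fixes w :: "(nat \<Rightarrow> 'a::field) \<Rightarrow> 'j \<Rightarrow> 'm \<Rightarrow> 'a"
  assumes "finite J" "\<And>j m. j \<in> J \<Longrightarrow> m \<in> M \<Longrightarrow> polyfun n (\<lambda>v. w v j m)"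
    and "indep_family J M (w v0)"
  shows "\<exists>g. polyfun n g \<and> g v0 \<noteq> 0 \<and> (\<forall>v. g v \<noteq> 0 \<longrightarrow> indep_family J M (w v))"
  using assms
proof (induction J arbitrary: w rule: finite_induct)
  case empty
  then show ?case by (intro exI[of _ "\<lambda>_. 1"]) (auto intro: pf_const simp: indep_family_def)
next
  case (insert i J)
  have "\<exists>m\<in>M. w v0 i m \<noteq> 0"
  proof (rule ccontr)
    assume "\<not> (\<exists>m\<in>M. w v0 i m \<noteq> 0)"
    then have "(\<Sum>j\<in>insert i J. (if j = i then 1 else 0) * w v0 j m) = 0" if "m \<in> M" for m
      using that by (auto intro!: sum.neutral)
    from indep_familyD[OF insert.prems(2) this, of i] show False by simp
  qed
  then obtain m0 where m0: "m0 \<in> M" "w v0 i m0 \<noteq> 0" by blast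
  \<comment> \<open>Coordinate \<open>m0\<close> is cleared by cross-multiplication instead of
    division, so the entries stay polynomial in \<open>v\<close>.\<close>
  define w' where "w' = (\<lambda>v j m. w v i m0 * w v j m - w v j m0 * w v i m)"
  have "indep_family J M (w' v0)"
    unfolding indep_family_def
  proof (intro allI impI ballI)
    fix k j assume k: "\<forall>m\<in>M. (\<Sum>j\<in>J. k j * w' v0 j m) = 0" and j: "j \<in> J"
    \<comment> \<open>A relation among the \<open>w' v0 j\<close>, rewritten for the
      \<open>w v0 j\<close>; the multiples of \<open>w v0 i\<close> collect in the first
      case.\<close>
    define k' where "k' = (\<lambda>j. if j = i then - (\<Sum>j\<in>J. k j * w v0 j m0) else w v0 i m0 * k j)"
    have "(\<Sum>j\<in>insert i J. k' j * w v0 j m) = 0" if "m \<in> M" for m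
    proof -
      have "(\<Sum>j\<in>J. k' j * w v0 j m) = (\<Sum>j\<in>J. w v0 i m0 * k j * w v0 j m)"
        using insert.hyps by (intro sum.cong) (auto simp: k'_def)
      then have "(\<Sum>j\<in>insert i J. k' j * w v0 j m) = (\<Sum>j\<in>J. k j * w' v0 j m)"
        using insert.hyps
        by (simp add: k'_def w'_def sum_distrib_left sum_distrib_right sum_subtractf algebra_simps)
      then show ?thesis using k that by simp
    qed
    from indep_familyD[OF insert.prems(2) this, of j] j show "k j = 0"
      using m0(2) insert.hyps by (auto simp: k'_def split: if_splits)
  qed
  moreover have "polyfun n (\<lambda>v. w' v j m)" if "j \<in> J" "m \<in> M" for j m
    unfolding w'_def using insert.prems(1) that m0(1)
    by (intro polyfun_diff pf_mult) auto
  ultimately obtain g where g: "polyfun n g" "g v0 \<noteq> 0"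
    "\<And>v. g v \<noteq> 0 \<Longrightarrow> indep_family J M (w' v)"
    using insert.IH[of w'] by blast
  show ?case
  proof (intro exI[of _ "\<lambda>v. w v i m0 * g v"] conjI allI impI)
    show "polyfun n (\<lambda>v. w v i m0 * g v)" using insert.prems(1) m0(1) g(1) by (intro pf_mult) auto
    show "w v0 i m0 * g v0 \<noteq> 0" using m0 g by simp
    fix v assume v: "w v i m0 * g v \<noteq> 0"
    show "indep_family (insert i J) M (w v)"
      unfolding indep_family_def
    proof (intro allI impI)
      fix k assume k: "\<forall>m\<in>M. (\<Sum>j\<in>insert i J. k j * w v j m) = 0"
      have k_eq: "(\<Sum>j\<in>J. k j * w v j m) = - (k i * w v i m)" if "m \<in> M" for m
        using k that insert.hyps by (simp add: add_eq_0_iff)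
      have "(\<Sum>j\<in>J. k j * w' v j m) = 0" if "m \<in> M" for m
      proof -
        have "(\<Sum>j\<in>J. k j * w' v j m)
          = w v i m0 * (\<Sum>j\<in>J. k j * w v j m) - (\<Sum>j\<in>J. k j * w v j m0) * w v i m"
          by (simp add: w'_def sum_distrib_left sum_distrib_right sum_subtractf algebra_simps)
        then show ?thesis using k_eq[OF that] k_eq[OF m0(1)] by simp
      qed
      with g(3)[of v] v have "\<forall>j\<in>J. k j = 0" unfolding indep_family_def by auto
      moreover from this have "k i = 0" using k_eq[OF m0(1)] v by simp
      ultimately show "\<forall>j\<in>insert i J. k j = 0" by simp
    qed
  qed
qed

subsection \<open>Fat points on two lines\<close>

text \<open>The divided derivative \<open>p^(b)(t) / b!\<close>, taken as a coefficient of
  \<open>p(t + x)\<close> to avoid division.\<close>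

definition taylor_coeff :: "'a::comm_ring_1 \<Rightarrow> 'a poly \<Rightarrow> nat \<Rightarrow> 'a" where
  "taylor_coeff t p b = coeff (pcompose p [:t, 1:]) b"

lemma taylor_coeff_0 [simp]: "taylor_coeff t 0 b = 0"
  by (simp add: taylor_coeff_def)

lemma taylor_coeff_add: "taylor_coeff t (p + q) b = taylor_coeff t p b + taylor_coeff t q b"
  by (simp add: taylor_coeff_def pcompose_add)

lemma taylor_coeff_smult: "taylor_coeff t (smult c p) b = c * taylor_coeff t p b"
  by (simp add: taylor_coeff_def pcompose_smult)

lemma taylor_coeff_minus: "taylor_coeff t (- p) b = - taylor_coeff t p b"
  by (simp add: taylor_coeff_def pcompose_uminus)

lemma taylor_coeff_diff: "taylor_coeff t (p - q) b = taylor_coeff t p b - taylor_coeff t q b"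
  by (simp add: taylor_coeff_def pcompose_diff)

lemma taylor_coeff_linear_power:
  "taylor_coeff t ([:- t, 1:] ^ e * G) b = (if b < e then 0 else taylor_coeff t G (b - e))"
proof -
  have "pcompose ([:- t, 1:] ^ e) [:t, 1:] = monom 1 e"
  proof -
    have "pcompose (p ^ e) q = pcompose p q ^ e" for p q :: "'a poly"
      by (induction e) (simp_all add: pcompose_1 pcompose_mult)
    then show ?thesis by (simp add: pcompose_pCons monom_altdef)
  qed
  then show ?thesis by (simp add: taylor_coeff_def pcompose_mult coeff_monom_mult)
qed

lemma taylor_coeff_dvd:
  "[:- t, 1:] ^ e dvd p \<Longrightarrow> b < e \<Longrightarrow> taylor_coeff t p b = 0"
  by (auto simp: taylor_coeff_linear_power elim!: dvdE)

text \<open>The weights of the coefficients of \<open>p\<close> are the entries of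
  \<open>jet_row\<close> in the \<open>t\<close> direction; this turns jet conditions into rows of a
  matrix.\<close>

lemma taylor_coeff_eq_sum:
  assumes "degree p \<le> N"
  shows "taylor_coeff t p b = (\<Sum>b'\<le>N. coeff p b' * (of_nat (b' choose b) * t ^ (b' - b)))"
proof -
  have "p = (\<Sum>b'\<le>N. monom (coeff p b') b')"
    using assms by (simp add: poly_as_sum_of_monoms')
  then have "pcompose p [:t, 1:] = (\<Sum>b'\<le>N. pcompose (monom (coeff p b') b') [:t, 1:])"
    by (metis pcompose_sum)
  also have "\<dots> = (\<Sum>b'\<le>N. smult (coeff p b') ([:t, 1:] ^ b'))"
  proof (intro sum.cong refl)
    fix b'
    have "pcompose (monom c b') [:t, 1:] = smult c ([:t, 1:] ^ b')" for c :: 'a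
      by (induction b') (auto simp: monom_0 monom_Suc pcompose_pCons)
    then show "pcompose (monom (coeff p b') b') [:t, 1:] = smult (coeff p b') ([:t, 1:] ^ b')" .
  qed
  finally have "taylor_coeff t p b = (\<Sum>b'\<le>N. coeff p b' * coeff ([:t, 1:] ^ b') b)"
    by (simp add: taylor_coeff_def coeff_sum)
  moreover have "coeff ([:t, 1:] ^ b') b = of_nat (b' choose b) * t ^ (b' - b)" for b'
  proof (cases "b \<le> b'")
    case True
    then show ?thesis by (simp add: coeff_linear_poly_power)
  next
    case False
    then have "degree ([:t, 1:] ^ b') < b" by (simp add: degree_linear_power)
    then show ?thesis using False by (simp add: coeff_eq_0 binomial_eq_0)
  qed
  ultimately show ?thesis by simp
qed

text \<open>The \<open>e\<close>-th test polynomial has its first nonzero Taylor coefficient at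
  order \<open>e\<close>, with value \<open>poly G t\<close>. The system is therefore triangular and
  is solved from the highest order downwards.\<close>

lemma taylor_combination_zero:
  fixes t :: "'a::field"
  assumes "\<And>e. e < r \<Longrightarrow> (\<Sum>b<r. k b * taylor_coeff t ([:- t, 1:] ^ e * G) b) = 0"
    and "poly G t \<noteq> 0" "b < r"
  shows "k b = 0"
  using assms(3)
proof (induction "r - b" arbitrary: b rule: less_induct)
  case less
  have "k b' * taylor_coeff t ([:- t, 1:] ^ b * G) b' = 0" if "b' < r" "b' \<noteq> b" for b'
  proof (cases "b' < b")
    case False
    then have "k b' = 0" using that less by (intro less.hyps) auto
    then show ?thesis by simp
  qed (simp add: taylor_coeff_linear_power)
  then have "(\<Sum>b'<r. k b' * taylor_coeff t ([:- t, 1:] ^ b * G) b')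
      = (\<Sum>b'\<in>{b}. k b' * taylor_coeff t ([:- t, 1:] ^ b * G) b')"
    using less.prems by (intro sum.mono_neutral_right) auto
  then have "k b * taylor_coeff t G 0 = 0"
    using assms(1)[OF less.prems] by (simp add: taylor_coeff_linear_power)
  moreover have "taylor_coeff t G 0 = poly G t"
    by (simp add: taylor_coeff_def pcompose_coeff_0)
  ultimately show ?case using assms(2) by simp
qed

text \<open>The abscissae are distinct across both lines because the points of both put conditions
  on the same univariate polynomials. Balance lets the extra orders required on one line be offset
  by the orders saved on the other.\<close>

locale two_line_points =
  fixes J1 J2 :: "'i set" and t :: "'i \<Rightarrow> 'a::field_char_0" and m :: "'i \<Rightarrow> nat" and d :: nat
  assumes finite_J: "finite J1" "finite J2" and disjoint: "J1 \<inter> J2 = {}"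
    and balanced: "card J2 \<le> card J1" "card J1 \<le> card J2 + 1"
    and inj_t: "inj_on t (J1 \<union> J2)"
    and m_ge_2: "\<And>i. i \<in> J1 \<union> J2 \<Longrightarrow> 2 \<le> m i"
    and sum_m: "(\<Sum>i\<in>J1 \<union> J2. m i - 1) + 1 \<le> d"
begin

definition orders :: "('i \<Rightarrow> nat) \<Rightarrow> 'i set \<Rightarrow> 'a poly" where
  "orders f S = (\<Prod>i\<in>S. [:- t i, 1:] ^ f i)"

lemma orders_monic: "lead_coeff (orders f S) = 1"
  by (simp add: orders_def lead_coeff_prod lead_coeff_power)

lemma degree_orders: "degree (orders f S) = (\<Sum>i\<in>S. f i)"
  unfolding orders_def
  by (subst degree_prod_eq_sum_degree) (auto simp: degree_linear_power)

lemma orders_dvd: "i \<in> S \<Longrightarrow> finite S \<Longrightarrow> [:- t i, 1:] ^ f i dvd orders f S"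
  unfolding orders_def by (rule dvd_prodI)

lemma poly_orders_nonzero:
  assumes "i \<in> J1 \<union> J2"
  shows "poly (orders f (J1 \<union> J2 - {i})) (t i) \<noteq> 0"
  using assms inj_t finite_J by (auto simp: orders_def poly_prod inj_on_def)

text \<open>Orders at \<open>t i\<close> that make \<alpha>, \<beta>, \<gamma> meet the conditions
  at the \<open>i\<close>-th point. Around \<open>u = 0\<close> the expansion in \<open>u\<close>
  has coefficients \<open>\<alpha>\<close>, \<open>- (2 \<alpha> + \<beta>)\<close>,
  \<open>\<alpha> + \<beta> + \<gamma>\<close>, which need orders \<open>m i\<close>,
  \<open>m i - 1\<close>, \<open>m i - 2\<close>; around \<open>u = 1\<close> the roles of \<alpha>
  and \<gamma> swap.\<close>

definition oA :: "'i \<Rightarrow> nat" where "oA i = (if i \<in> J1 then m i else m i - 2)"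
definition oB :: "'i \<Rightarrow> nat" where "oB i = m i - 1"
definition oC :: "'i \<Rightarrow> nat" where "oC i = (if i \<in> J1 then m i - 2 else m i)"

text \<open>Relative to \<open>m i - 1\<close>, each point of \<open>J1\<close> costs one more and
  each point of \<open>J2\<close> one less, so the excess is \<open>card J1 - card J2\<close>, at
  most one.\<close>

lemma sum_oA: "(\<Sum>i\<in>J1 \<union> J2. oA i) \<le> d"
proof -
  have "oA i = (m i - 1) + 1" if "i \<in> J1" for i
    using m_ge_2[of i] that by (simp add: oA_def)
  then have "(\<Sum>i\<in>J1. oA i) = (\<Sum>i\<in>J1. (m i - 1) + 1)" by simp
  moreover have "oA i + 1 = m i - 1" if "i \<in> J2" for i
    using m_ge_2[of i] that disjoint by (auto simp: oA_def)
  then have "(\<Sum>i\<in>J2. oA i + 1) = (\<Sum>i\<in>J2. m i - 1)" by simp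
  ultimately show ?thesis
    using sum_m balanced finite_J disjoint by (simp add: sum.union_disjoint sum.distrib sum_Suc)
qed

text \<open>Here the excess is \<open>card J2 - card J1\<close>, which is never positive; this keeps
  the test polynomials for \<gamma> within degree \<open>d - 2\<close>.\<close>

lemma sum_oC: "(\<Sum>i\<in>J1 \<union> J2. oC i) + 1 \<le> d"
proof -
  have "oC i = (m i - 1) + 1" if "i \<in> J2" for i
    using m_ge_2[of i] that disjoint by (auto simp: oC_def)
  then have "(\<Sum>i\<in>J2. oC i) = (\<Sum>i\<in>J2. (m i - 1) + 1)" by simp
  moreover have "oC i + 1 = m i - 1" if "i \<in> J1" for i
    using m_ge_2[of i] that by (simp add: oC_def)
  then have "(\<Sum>i\<in>J1. oC i + 1) = (\<Sum>i\<in>J1. m i - 1)" by simp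
  ultimately show ?thesis
    using sum_m balanced finite_J disjoint by (simp add: sum.union_disjoint sum.distrib sum_Suc)
qed

text \<open>The conditions at the \<open>i\<close>-th point on the conic-bundle polynomial
  \<open>\<alpha> (u - 1)\<^sup>2 + \<beta> u (u - 1) + \<gamma> u\<^sup>2\<close>: the point lies on \<open>u = 0\<close> for \<open>i \<in> J1\<close> and on
  \<open>u = 1\<close> for \<open>i \<in> J2\<close>.\<close>
definition jet :: "('i \<Rightarrow> nat \<Rightarrow> nat \<Rightarrow> 'a) \<Rightarrow> 'i \<Rightarrow> 'a poly \<Rightarrow> 'a poly \<Rightarrow> 'a poly \<Rightarrow> 'a" where
  "jet k i \<alpha> \<beta> \<gamma> =
     (\<Sum>b<m i. k i b 0 * taylor_coeff (t i) (if i \<in> J1 then \<alpha> else \<gamma>) b)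
   + (\<Sum>b<m i - 1. (if i \<in> J1 then - k i b 1 else k i b 1) *
        taylor_coeff (t i) (smult 2 (if i \<in> J1 then \<alpha> else \<gamma>) + \<beta>) b)
   + (\<Sum>b<m i - 2. k i b 2 * taylor_coeff (t i) (\<alpha> + \<beta> + \<gamma>) b)"

lemma jet_eq_0:
  assumes i: "i \<in> J1 \<union> J2"
    and dvd: "[:- t i, 1:] ^ oA i dvd \<alpha>" "[:- t i, 1:] ^ oB i dvd \<beta>" "[:- t i, 1:] ^ oC i dvd \<gamma>"
  shows "jet k i \<alpha> \<beta> \<gamma> = 0"
proof -
  have *: "b < oA i \<Longrightarrow> taylor_coeff (t i) \<alpha> b = 0" "b < oB i \<Longrightarrow> taylor_coeff (t i) \<beta> b = 0"
    "b < oC i \<Longrightarrow> taylor_coeff (t i) \<gamma> b = 0" for b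
    using dvd by (blast intro: taylor_coeff_dvd)+
  show ?thesis
    by (cases "i \<in> J1")
      (simp_all add: jet_def taylor_coeff_add taylor_coeff_smult * oA_def oB_def oC_def)
qed

text \<open>Testing with triples that meet every condition at the other points isolates the jet at
  \<open>i\<close>. Multiplying by powers of \<open>X\<close> then gives triangular systems for
  \<open>taylor_combination_zero\<close>.\<close>

lemma jets_independent:
  assumes "\<And>\<alpha> \<beta> \<gamma>. degree \<alpha> \<le> d \<Longrightarrow> degree (smult 2 \<alpha> + \<beta>) \<le> d - 1
      \<Longrightarrow> degree (\<alpha> + \<beta> + \<gamma>) \<le> d - 2 \<Longrightarrow> (\<Sum>i\<in>J1 \<union> J2. jet k i \<alpha> \<beta> \<gamma>) = 0"
    and i: "i \<in> J1 \<union> J2"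
  shows "\<forall>b<m i. k i b 0 = 0" "\<forall>b<m i - 1. k i b 1 = 0" "\<forall>b<m i - 2. k i b 2 = 0"
proof -
  let ?H = "J1 \<union> J2"
  have fin: "finite ?H" using finite_J by simp
  define Q where "Q = (\<lambda>f. orders f (?H - {i}))"
  define X where "X = [:- t i, 1:]"
  have jet_i: "jet k i \<alpha> \<beta> \<gamma> = 0"
    if "degree \<alpha> \<le> d" "degree (smult 2 \<alpha> + \<beta>) \<le> d - 1" "degree (\<alpha> + \<beta> + \<gamma>) \<le> d - 2"
      and dvd: "Q oA dvd \<alpha>" "Q oB dvd \<beta>" "Q oC dvd \<gamma>" for \<alpha> \<beta> \<gamma>
  proof -
    have "jet k i' \<alpha> \<beta> \<gamma> = 0" if i': "i' \<in> ?H - {i}" for i'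
    proof -
      have "[:- t i', 1:] ^ f i' dvd Q f" for f
        unfolding Q_def using i' fin by (intro orders_dvd) auto
      then show ?thesis using i' dvd by (intro jet_eq_0) (blast intro: dvd_trans)+
    qed
    then have "(\<Sum>i\<in>?H. jet k i \<alpha> \<beta> \<gamma>) = jet k i \<alpha> \<beta> \<gamma>"
      using i fin by (simp add: sum.remove[of ?H i])
    then show ?thesis using assms(1)[OF that(1-3)] by simp
  qed
  \<comment> \<open>Strictness gives the degree bounds: \<open>d - 1\<close> for \<alpha>, and
    \<open>d - 2\<close> for \<beta> and \<gamma>.\<close>
  have degQ: "degree (X ^ e * Q f) < (\<Sum>i\<in>?H. f i)" if "e < f i" for e f
  proof -
    have "degree (X ^ e * Q f) \<le> degree (X ^ e) + degree (Q f)" by (rule degree_mult_le)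
    also have "\<dots> = e + (\<Sum>i\<in>?H - {i}. f i)"
      by (simp add: X_def Q_def degree_linear_power degree_orders)
    also have "\<dots> < (\<Sum>i\<in>?H. f i)" using that fin i by (simp add: sum.remove[of ?H i f])
    finally show ?thesis .
  qed
  have Q0: "poly (Q f) (t i) \<noteq> 0" for f unfolding Q_def by (rule poly_orders_nonzero[OF i])
  have "m i - 1 \<le> (\<Sum>i\<in>?H. m i - 1)" by (rule member_le_sum[OF i _ fin]) auto
  then have d: "2 \<le> d" using sum_m m_ge_2[OF i] by linarith
  define \<beta>0 where "\<beta>0 = orders oB ?H"
  have deg\<beta>0: "degree \<beta>0 = (\<Sum>i\<in>?H. oB i)" by (simp add: \<beta>0_def degree_orders)
  have \<beta>0_le: "degree \<beta>0 \<le> d - 1" using sum_m unfolding deg\<beta>0 oB_def by simp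
  \<comment> \<open>\<open>\<beta>1 e\<close> meets all conditions and cancels the coefficient of degree \<open>d - 1\<close> of \<open>\<alpha>\<close>, which the
    degree bound on \<open>\<alpha> + \<beta> + \<gamma>\<close> forbids.\<close>
  define \<beta>1 where "\<beta>1 = (\<lambda>e. - smult (coeff (X ^ e * Q oA) (d - 1)) (\<beta>0 * monom 1 (d - 1 - degree \<beta>0)))"
  have Xdvd: "X ^ oB i dvd \<beta>1 e" "Q oB dvd \<beta>1 e" for e
  proof -
    have "X ^ oB i dvd \<beta>0" unfolding \<beta>0_def X_def by (rule orders_dvd[OF i fin])
    then show "X ^ oB i dvd \<beta>1 e" unfolding \<beta>1_def by (simp add: dvd_smult)
    have "\<beta>0 = X ^ oB i * Q oB"
      unfolding \<beta>0_def X_def Q_def orders_def by (rule prod.remove[OF fin i])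
    then have "Q oB dvd \<beta>0" by simp
    then show "Q oB dvd \<beta>1 e" unfolding \<beta>1_def by (simp add: dvd_smult)
  qed
  have \<beta>1_0: "taylor_coeff (t i) (\<beta>1 e) b = 0" if "b < m i - 1" for b e
    using taylor_coeff_dvd[of "t i" "oB i" "\<beta>1 e" b] Xdvd(1)[of e] that by (simp add: X_def oB_def)
  have jet\<alpha>: "jet k i (X ^ e * Q oA) (\<beta>1 e) 0 = 0" if "e < oA i" for e
  proof (rule jet_i)
    let ?\<alpha> = "X ^ e * Q oA"
    have \<alpha>: "degree ?\<alpha> \<le> d - 1" using degQ[of e oA, OF that] sum_oA by linarith
    then show "degree ?\<alpha> \<le> d" by simp
    have \<beta>: "degree (\<beta>1 e) \<le> d - 1"
    proof -
      have "degree (\<beta>0 * monom 1 (d - 1 - degree \<beta>0)) \<le> degree \<beta>0 + (d - 1 - degree \<beta>0)"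
        by (metis degree_mult_le degree_monom_eq one_neq_zero)
      then show ?thesis unfolding \<beta>1_def degree_minus
        using degree_smult_le \<beta>0_le by (metis le_add_diff_inverse le_trans)
    qed
    show "degree (smult 2 ?\<alpha> + \<beta>1 e) \<le> d - 1"
      using \<alpha> \<beta> by (intro degree_add_le) (auto intro: le_trans[OF degree_smult_le])
    have "coeff (\<beta>1 e) (d - 1) = - coeff ?\<alpha> (d - 1)"
    proof -
      have "coeff (\<beta>0 * monom 1 (d - 1 - degree \<beta>0)) (d - 1) = coeff \<beta>0 (degree \<beta>0)"
      proof -
        obtain r where r: "d - 1 = degree \<beta>0 + r" using \<beta>0_le le_Suc_ex by blast
        show ?thesis unfolding r by (subst mult.commute) (simp add: coeff_monom_mult)
      qed
      then show ?thesis unfolding \<beta>1_def \<beta>0_def by (simp add: orders_monic)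
    qed
    then have "coeff (?\<alpha> + \<beta>1 e) (d - 1) = 0" by simp
    moreover have "degree (?\<alpha> + \<beta>1 e) \<le> d - 1" using \<alpha> \<beta> by (rule degree_add_le)
    ultimately have "coeff (?\<alpha> + \<beta>1 e) j = 0" if "d - 2 < j" for j
    proof (cases "j = d - 1")
      case False
      then have "degree (?\<alpha> + \<beta>1 e) < j"
        using that \<open>degree (?\<alpha> + \<beta>1 e) \<le> d - 1\<close> by linarith
      then show ?thesis by (rule coeff_eq_0)
    qed (use \<open>coeff (?\<alpha> + \<beta>1 e) (d - 1) = 0\<close> in simp)
    then have "degree (?\<alpha> + \<beta>1 e) \<le> d - 2" by (intro degree_le) blast
    then show "degree (?\<alpha> + \<beta>1 e + 0) \<le> d - 2" by simp
  qed (use Xdvd in auto)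
  have jet\<beta>: "jet k i 0 (X ^ e * Q oB) 0 = 0" if "e < oB i" for e
    by (rule jet_i) (use degQ[of e oB, OF that] \<beta>0_le deg\<beta>0 in auto)
  have jet\<gamma>: "jet k i 0 0 (X ^ e * Q oC) = 0" if "e < oC i" for e
    by (rule jet_i) (use degQ[of e oC, OF that] sum_oC in auto)
  have chan: "\<forall>b<r. k' b = 0"
    if "\<And>e. e < r \<Longrightarrow> (\<Sum>b<r. k' b * taylor_coeff (t i) (X ^ e * Q f) b) = 0" for r k' f
    using taylor_combination_zero[of r k' "t i" "Q f"] Q0 that unfolding X_def by blast
  have zero: "(\<Sum>b<r. k' b * f b) = 0" if "\<forall>b<r. k' b = 0" for r k' and f :: "nat \<Rightarrow> 'a"
    using that by (intro sum.neutral) auto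
  have "(\<forall>b<m i. k i b 0 = 0) \<and> (\<forall>b<m i - 1. k i b 1 = 0) \<and> (\<forall>b<m i - 2. k i b 2 = 0)"
  proof (cases "i \<in> J1")
    case True
    \<comment> \<open>On \<open>u = 0\<close> a test by \<gamma> involves only
      \<open>k i b 2\<close>, one by \<beta> also \<open>k i b 1\<close>, one by \<alpha> all three,
      so the coefficients are shown to vanish in this order.\<close>
    have k2: "\<forall>b<m i - 2. k i b 2 = 0"
    proof (rule chan[where f = oC])
      fix e assume "e < m i - 2"
      then show "(\<Sum>b<m i - 2. k i b 2 * taylor_coeff (t i) (X ^ e * Q oC) b) = 0"
        using jet\<gamma>[of e] True by (simp add: jet_def oC_def)
    qed
    have "\<forall>b<m i - 1. - k i b 1 = 0"
    proof (rule chan[where f = oB])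
      fix e assume "e < m i - 1"
      then show "(\<Sum>b<m i - 1. - k i b 1 * taylor_coeff (t i) (X ^ e * Q oB) b) = 0"
        using jet\<beta>[of e] True zero[OF k2] by (simp add: jet_def oB_def)
    qed
    then have k1: "\<forall>b<m i - 1. k i b 1 = 0" by simp
    have "\<forall>b<m i. k i b 0 = 0"
    proof (rule chan[where f = oA])
      fix e assume "e < m i"
      then show "(\<Sum>b<m i. k i b 0 * taylor_coeff (t i) (X ^ e * Q oA) b) = 0"
        using jet\<alpha>[of e] zero[OF k2] zero[OF k1] True by (simp add: jet_def oA_def sum_negf)
    qed
    with k1 k2 show ?thesis by simp
  next
    case False
    \<comment> \<open>On \<open>u = 1\<close> the order is reversed: \<alpha> only meets
      \<open>k i b 2\<close>. The correction \<open>\<beta>1 e\<close> is invisible, since it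
      vanishes to order \<open>m i - 1\<close> at \<open>t i\<close>.\<close>
    have k2: "\<forall>b<m i - 2. k i b 2 = 0"
    proof (rule chan[where f = oA])
      fix e assume e: "e < m i - 2"
      have "(\<Sum>b<m i - 1. k i b 1 * taylor_coeff (t i) (\<beta>1 e) b) = 0"
        using \<beta>1_0 by (intro sum.neutral) auto
      moreover have "(\<Sum>b<m i - 2. k i b 2 * taylor_coeff (t i) (X ^ e * Q oA + \<beta>1 e) b)
        = (\<Sum>b<m i - 2. k i b 2 * taylor_coeff (t i) (X ^ e * Q oA) b)"
        using \<beta>1_0 by (intro sum.cong) (auto simp: taylor_coeff_add)
      ultimately show "(\<Sum>b<m i - 2. k i b 2 * taylor_coeff (t i) (X ^ e * Q oA) b) = 0"
        using jet\<alpha>[of e] e False by (simp add: jet_def oA_def)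
    qed
    have k1: "\<forall>b<m i - 1. k i b 1 = 0"
    proof (rule chan[where f = oB])
      fix e assume "e < m i - 1"
      then show "(\<Sum>b<m i - 1. k i b 1 * taylor_coeff (t i) (X ^ e * Q oB) b) = 0"
        using jet\<beta>[of e] False zero[OF k2] by (simp add: jet_def oB_def)
    qed
    have "\<forall>b<m i. k i b 0 = 0"
    proof (rule chan[where f = oC])
      fix e assume "e < m i"
      then show "(\<Sum>b<m i. k i b 0 * taylor_coeff (t i) (X ^ e * Q oC) b) = 0"
        using jet\<gamma>[of e] zero[OF k2] zero[OF k1] False by (simp add: jet_def oC_def)
    qed
    with k1 k2 show ?thesis by simp
  qed
  then show "\<forall>b<m i. k i b 0 = 0" "\<forall>b<m i - 1. k i b 1 = 0" "\<forall>b<m i - 2. k i b 2 = 0" by auto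
qed

end

subsection \<open>General points of multiplicity one\<close>

text \<open>The pair \<open>(c, b)\<close> stands for \<open>t^b u^c\<close>, or homogeneously for
  \<open>x^(d - b - c) y^b z^c\<close>; for \<open>d \<ge> 2\<close> these form a basis in degree
  \<open>d\<close> modulo \<open>z^3\<close>.\<close>

definition coords :: "nat \<Rightarrow> (nat \<times> nat) set" where
  "coords d = (SIGMA c:{..2}. {..d - c})"

text \<open>Orders \<open>c > 2\<close> impose nothing on polynomials of degree at most 2 in
  \<open>u\<close>. A point with \<open>m i \<ge> 2\<close> thus gives \<open>3 * (m i - 1)\<close>
  conditions, a point with \<open>m i = 1\<close> a single one.\<close>

definition jet_index :: "('i \<Rightarrow> nat) \<Rightarrow> 'i set \<Rightarrow> ('i \<times> nat \<times> nat) set" where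
  "jet_index m I = (SIGMA i:I. SIGMA c:{..2}. {..<m i - c})"

text \<open>The coefficient of \<open>\<epsilon>\<^sup>b \<delta>\<^sup>c\<close> in \<open>(t + \<epsilon>)\<^sup>x (u + \<delta>)\<^sup>y\<close>, as a function of \<open>(y, x)\<close>.\<close>
definition jet_row :: "'a::comm_semiring_1 \<Rightarrow> 'a \<Rightarrow> nat \<times> nat \<Rightarrow> nat \<times> nat \<Rightarrow> 'a" where
  "jet_row t u = (\<lambda>(c, b) (c', b').
     of_nat (c' choose c) * u ^ (c' - c) * (of_nat (b' choose b) * t ^ (b' - b)))"

lemma finite_coords [simp]: "finite (coords d)"
  by (simp add: coords_def)

lemma finite_jet_index [simp]: "finite I \<Longrightarrow> finite (jet_index m I)"
  by (auto simp: jet_index_def)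

lemma sum_atMost_2: "(\<Sum>c\<le>2. f c) = f 0 + f 1 + f (2::nat)" for f :: "nat \<Rightarrow> 'b::comm_monoid_add"
  by (simp add: numeral_2_eq_2)

lemma sum_coords: "(\<Sum>x\<in>coords d. f x) = (\<Sum>c\<le>2. \<Sum>b\<le>d - c. f (c, b))"
  unfolding coords_def by (subst sum.Sigma) auto

lemma sum_jet_index:
  "finite I \<Longrightarrow> (\<Sum>x\<in>jet_index m I. f x) = (\<Sum>i\<in>I. \<Sum>c\<le>2. \<Sum>b<m i - c. f (i, c, b))"
  unfolding jet_index_def by (simp add: sum.Sigma split_def)

lemma card_coords: "2 \<le> d \<Longrightarrow> card (coords d) = 3 * d"
  by (simp add: coords_def card_SigmaI sum_atMost_2)

lemma card_jet_index:
  "finite I \<Longrightarrow> card (jet_index m I) = (\<Sum>i\<in>I. m i + (m i - 1) + (m i - 2))"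
  by (simp add: jet_index_def card_SigmaI sum_atMost_2)

lemma jet_index_Un: "jet_index m (I \<union> J) = jet_index m I \<union> jet_index m J"
  by (auto simp: jet_index_def)

text \<open>A nonzero polynomial over an infinite field has a nonzero value; the point is found one
  coordinate at a time.\<close>

lemma exists_nonvanishing_point:
  fixes F :: "nat \<times> nat \<Rightarrow> 'a::field_char_0"
  assumes "x \<in> coords d" "F x \<noteq> 0"
  shows "\<exists>t u. (\<Sum>x\<in>coords d. jet_row t u (0, 0) x * F x) \<noteq> 0"
proof -
  obtain c0 b0 where x: "x = (c0, b0)" "c0 \<le> 2" "b0 \<le> d - c0"
    using assms(1) by (auto simp: coords_def)
  define p where "p = (\<lambda>c. \<Sum>b\<le>d - c. monom (F (c, b)) b)"
  have "coeff (p c0) b0 = F x" using x by (simp add: p_def coeff_sum sum.delta)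
  then have "p c0 \<noteq> 0" using assms(2) by auto
  then obtain t where t: "poly (p c0) t \<noteq> 0" using poly_all_0_iff_0 by blast
  define q where "q = (\<Sum>c\<le>2. monom (poly (p c) t) c)"
  have "coeff q c0 = poly (p c0) t" using x by (simp add: q_def coeff_sum sum.delta)
  then have "q \<noteq> 0" using t by auto
  then obtain u where u: "poly q u \<noteq> 0" using poly_all_0_iff_0 by blast
  have "poly q u = (\<Sum>x\<in>coords d. jet_row t u (0, 0) x * F x)"
    by (simp add: q_def p_def poly_sum poly_monom sum_coords jet_row_def sum_distrib_right
        sum_distrib_left mult_ac)
  then show ?thesis using u by metis
qed

lemma extend_by_simple_points:
  fixes t u :: "'i \<Rightarrow> 'a::field_char_0"
  assumes "finite S" "finite I" "S \<inter> I = {}" "\<And>i. i \<in> S \<Longrightarrow> m i = 1"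
    and "card (jet_index m (I \<union> S)) \<le> card (coords d)"
    and "indep_family (jet_index m I) (coords d) (\<lambda>(i, cb). jet_row (t i) (u i) cb)"
  shows "\<exists>t u :: 'i \<Rightarrow> 'a. indep_family (jet_index m (I \<union> S)) (coords d) (\<lambda>(i, cb). jet_row (t i) (u i) cb)"
  using assms
proof (induction S rule: finite_induct)
  case empty
  then show ?case by auto
next
  case (insert i S)
  let ?J = "jet_index m (I \<union> S)"
  have i: "i \<notin> I \<union> S" using insert by auto
  have new: "jet_index m (I \<union> insert i S) = insert (i, 0, 0) ?J"
    using insert.prems(3)[of i] by (auto simp: jet_index_def)
  have fin: "finite ?J" using insert by simp
  have notin: "(i, 0, 0) \<notin> ?J" using i by (auto simp: jet_index_def)
  have card: "card ?J < card (coords d)" using insert.prems(4) fin notin unfolding new by simp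
  obtain t u :: "'i \<Rightarrow> 'a" where
    tu: "indep_family ?J (coords d) (\<lambda>(i, cb). jet_row (t i) (u i) cb)"
    using insert card by auto
  let ?w = "\<lambda>t u. \<lambda>(i, cb). jet_row (t i) (u i) cb"
  obtain F where F: "\<exists>x\<in>coords d. F x \<noteq> 0" "\<And>e. e \<in> ?J \<Longrightarrow> (\<Sum>x\<in>coords d. ?w t u e x * F x) = 0"
    using underdetermined_nontrivial_solution[OF fin finite_coords card, of "?w t u"] by blast
  obtain \<tau> \<upsilon> where pt: "(\<Sum>x\<in>coords d. jet_row \<tau> \<upsilon> (0, 0) x * F x) \<noteq> 0"
    using F(1) exists_nonvanishing_point by blast
  let ?t = "t(i := \<tau>)" and ?u = "u(i := \<upsilon>)"
  have same: "?w ?t ?u e x = ?w t u e x" if "e \<in> ?J" for e x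
    using that i by (auto simp: jet_index_def)
  have "indep_family (insert (i, 0, 0) ?J) (coords d) (?w ?t ?u)"
    unfolding indep_family_def
  proof (intro allI impI)
    fix k assume k: "\<forall>x\<in>coords d. (\<Sum>e\<in>insert (i, 0, 0) ?J. k e * ?w ?t ?u e x) = 0"
    have rel: "k (i, 0, 0) * jet_row \<tau> \<upsilon> (0, 0) x + (\<Sum>e\<in>?J. k e * ?w t u e x) = 0"
      if "x \<in> coords d" for x
    proof -
      have "(\<Sum>e\<in>?J. k e * ?w ?t ?u e x) = (\<Sum>e\<in>?J. k e * ?w t u e x)"
        using same by (intro sum.cong) auto
      moreover have "(\<Sum>e\<in>insert (i, 0, 0) ?J. k e * ?w ?t ?u e x) = 0"
        using k that by blast
      ultimately show ?thesis
        by (simp only: sum.insert[OF fin notin] prod.case fun_upd_same)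
    qed
    \<comment> \<open>Pairing the relation with \<open>F\<close> removes the old rows and leaves the
      coefficient of the new one times a nonzero value.\<close>
    have "0 = (\<Sum>x\<in>coords d. (k (i, 0, 0) * jet_row \<tau> \<upsilon> (0, 0) x + (\<Sum>e\<in>?J. k e * ?w t u e x)) * F x)"
      using rel by simp
    also have "\<dots> = k (i, 0, 0) * (\<Sum>x\<in>coords d. jet_row \<tau> \<upsilon> (0, 0) x * F x)
        + (\<Sum>x\<in>coords d. \<Sum>e\<in>?J. k e * (?w t u e x * F x))"
      by (simp add: sum.distrib sum_distrib_left sum_distrib_right algebra_simps)
    also have "(\<Sum>x\<in>coords d. \<Sum>e\<in>?J. k e * (?w t u e x * F x))
        = (\<Sum>e\<in>?J. k e * (\<Sum>x\<in>coords d. ?w t u e x * F x))"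
      by (subst sum.swap) (simp add: sum_distrib_left)
    also have "\<dots> = 0" using F(2) by simp
    finally have k0: "k (i, 0, 0) = 0" using pt by simp
    then have "\<forall>e\<in>?J. k e = 0" using tu rel unfolding indep_family_def by simp
    then show "\<forall>e\<in>insert (i, 0, 0) ?J. k e = 0" using k0 by simp
  qed
  then show ?case unfolding new by blast
qed

section \<open>The two-line configuration in matrix form\<close>

context two_line_points
begin

lemma two_line_rows_independent:
  assumes "2 \<le> d"
  shows "indep_family (jet_index m (J1 \<union> J2)) (coords d)
           (\<lambda>(i, cb). jet_row (t i) (if i \<in> J1 then 0 else 1) cb)"
  unfolding indep_family_def
proof (intro allI impI ballI)
  let ?H = "J1 \<union> J2"
  let ?u = "\<lambda>i. if i \<in> J1 then 0 else 1 :: 'a"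
  fix k x
  assume k: "\<forall>x\<in>coords d. (\<Sum>e\<in>jet_index m ?H. k e * (case e of (i, cb) \<Rightarrow> jet_row (t i) (?u i) cb) x) = 0"
    and x: "x \<in> jet_index m ?H"
  define k' where "k' = (\<lambda>i b c. k (i, c, b))"
  have sum0: "(\<Sum>i\<in>?H. jet k' i \<alpha> \<beta> \<gamma>) = 0"
    if deg: "degree \<alpha> \<le> d" "degree (smult 2 \<alpha> + \<beta>) \<le> d - 1" "degree (\<alpha> + \<beta> + \<gamma>) \<le> d - 2"
    for \<alpha> \<beta> \<gamma> :: "'a poly"
  proof -
    \<comment> \<open>Coefficients of \<open>u^0\<close>, \<open>u^1\<close>, \<open>u^2\<close> in
      \<open>\<alpha> (u - 1)^2 + \<beta> u (u - 1) + \<gamma> u^2\<close>; pairing the relation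
      with them yields the sum of jets.\<close>
    define F where "F = (\<lambda>c::nat. if c = 0 then \<alpha> else if c = 1 then - (smult 2 \<alpha> + \<beta>) else \<alpha> + \<beta> + \<gamma>)"
    have degF: "degree (F c) \<le> d - c" if "c \<le> 2" for c
    proof -
      have "c = 0 \<or> c = 1 \<or> c = 2" using that by auto
      then show ?thesis using deg by (auto simp: F_def simp del: minus_add_distrib)
    qed
    have row: "(\<Sum>x\<in>coords d. jet_row (t i) (?u i) (c, b) x * coeff (F (fst x)) (snd x))
        = (\<Sum>c'\<le>2. of_nat (c' choose c) * ?u i ^ (c' - c) * taylor_coeff (t i) (F c') b)" for i c b
      unfolding sum_coords jet_row_def
      by (intro sum.cong refl)
        (simp add: taylor_coeff_eq_sum[OF degF] sum_distrib_left mult_ac)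
    have "0 = (\<Sum>x\<in>coords d. (\<Sum>e\<in>jet_index m ?H. k e * (case e of (i, cb) \<Rightarrow> jet_row (t i) (?u i) cb) x)
              * coeff (F (fst x)) (snd x))"
      using k by simp
    also have "\<dots> = (\<Sum>e\<in>jet_index m ?H. k e * (\<Sum>x\<in>coords d.
              (case e of (i, cb) \<Rightarrow> jet_row (t i) (?u i) cb) x * coeff (F (fst x)) (snd x)))"
      by (simp only: sum_distrib_right sum_distrib_left mult.assoc) (rule sum.swap)
    also have "\<dots> = (\<Sum>i\<in>?H. \<Sum>c\<le>2. \<Sum>b<m i - c. k (i, c, b) *
              (\<Sum>c'\<le>2. of_nat (c' choose c) * ?u i ^ (c' - c) * taylor_coeff (t i) (F c') b))"
      using finite_J by (subst sum_jet_index) (simp_all only: finite_Un prod.case row)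
    also have "\<dots> = (\<Sum>i\<in>?H. jet k' i \<alpha> \<beta> \<gamma>)"
    proof (intro sum.cong refl)
      fix i assume "i \<in> ?H"
      show "(\<Sum>c\<le>2. \<Sum>b<m i - c. k (i, c, b) *
              (\<Sum>c'\<le>2. of_nat (c' choose c) * ?u i ^ (c' - c) * taylor_coeff (t i) (F c') b))
            = jet k' i \<alpha> \<beta> \<gamma>"
        by (cases "i \<in> J1")
          (simp_all add: sum_atMost_2 jet_def k'_def F_def taylor_coeff_add taylor_coeff_minus
            taylor_coeff_diff taylor_coeff_smult binomial_eq_0 algebra_simps)
    qed
    finally show ?thesis by simp
  qed
  obtain i c b where x': "x = (i, c, b)" "i \<in> ?H" "c \<le> 2" "b < m i - c"
    using x by (auto simp: jet_index_def)
  have "c = 0 \<or> c = 1 \<or> c = 2" using x' by auto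
  then show "k x = 0"
    using jets_independent[of k', OF sum0 x'(2)] x' by (auto simp: k'_def)
qed

end

lemma exists_independent_rows:
  fixes m :: "nat \<Rightarrow> nat"
  assumes "finite I" "\<And>i. i \<in> I \<Longrightarrow> 1 \<le> m i" "2 \<le> d" "(\<Sum>i\<in>I. m i - 1) + 1 \<le> d"
    and "card (jet_index m I) \<le> card (coords d)"
  shows "\<exists>t u :: nat \<Rightarrow> 'a::field_char_0.
           indep_family (jet_index m I) (coords d) (\<lambda>(i, cb). jet_row (t i) (u i) cb)"
proof -
  define H where "H = {i \<in> I. 2 \<le> m i}"
  have H: "finite H" "H \<subseteq> I" using assms(1) by (auto simp: H_def)
  \<comment> \<open>Rounding down makes \<open>J2\<close> the smaller half, as
    \<open>balanced\<close> demands.\<close>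
  obtain J2 where J2: "J2 \<subseteq> H" "card J2 = card H div 2"
    using obtain_subset_with_card_n[of "card H div 2" H] by auto
  define J1 where "J1 = H - J2"
  have fin: "finite J2" using H J2 finite_subset by auto
  have card1: "card J1 = card H - card H div 2" unfolding J1_def using fin J2 by (simp add: card_Diff_subset)
  have Un: "J1 \<union> J2 = H" using J2 by (auto simp: J1_def)
  \<comment> \<open>The abscissae \<open>of_nat i\<close> are distinct in characteristic
    zero.\<close>
  interpret two_line_points J1 J2 "of_nat :: nat \<Rightarrow> 'a" m d
  proof
    show "inj_on (of_nat :: nat \<Rightarrow> 'a) (J1 \<union> J2)" by (simp add: inj_on_def)
    have "(\<Sum>i\<in>H. m i - 1) \<le> (\<Sum>i\<in>I. m i - 1)" using H assms(1) by (intro sum_mono2) auto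
    then show "(\<Sum>i\<in>J1 \<union> J2. m i - 1) + 1 \<le> d" using assms(4) unfolding Un by linarith
  qed (use H fin Un J2 card1 in \<open>auto simp: J1_def H_def\<close>)
  have I: "I = H \<union> (I - H)" using H by auto
  have "\<exists>t u :: nat \<Rightarrow> 'a. indep_family (jet_index m (H \<union> (I - H))) (coords d)
      (\<lambda>(i, cb). jet_row (t i) (u i) cb)"
  proof (rule extend_by_simple_points)
    show "indep_family (jet_index m H) (coords d)
      (\<lambda>(i, cb). jet_row (of_nat i :: 'a) (if i \<in> J1 then 0 else 1) cb)"
      using two_line_rows_independent[OF assms(3)] unfolding Un .
    show "m i = 1" if "i \<in> I - H" for i using that assms(2)[of i] by (auto simp: H_def)
    show "card (jet_index m (H \<union> (I - H))) \<le> card (coords d)" using I assms(5) by simp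
  qed (use H assms(1) in auto)
  then show ?thesis using I by simp
qed

subsection \<open>Homogeneous polynomials in three variables\<close>

abbreviation (input) "lookup \<equiv> Poly_Mapping.lookup"
abbreviation (input) "single \<equiv> Poly_Mapping.single"

lemma mdeg_add: "mdeg (m + m') = mdeg m + mdeg m'"
  by (simp add: mdeg_def)

lemma lookup_single_mult:
  fixes f :: "'a::comm_ring_1 poly3"
  shows "lookup (single (i, j, k) c * f) (i', j', k') =
    (if i \<le> i' \<and> j \<le> j' \<and> k \<le> k' then c * lookup f (i' - i, j' - j, k' - k) else 0)"
proof -
  have eq: "(i', j', k') = (i, j, k) + q \<longleftrightarrow> i \<le> i' \<and> j \<le> j' \<and> k \<le> k' \<and> q = (i' - i, j' - j, k' - k)"
    for q :: "nat \<times> nat \<times> nat"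
    by (cases q) auto
  have "lookup (single (i, j, k) c * f) (i', j', k')
      = c * (\<Sum>q. lookup f q when (i', j', k') = (i, j, k) + q)"
    by (simp add: lookup_mult lookup_single when_mult)
  also have "(\<Sum>q. lookup f q when (i', j', k') = (i, j, k) + q)
      = (\<Sum>q. (lookup f (i' - i, j' - j, k' - k) when i \<le> i' \<and> j \<le> j' \<and> k \<le> k')
            when q = (i' - i, j' - j, k' - k))"
    unfolding eq by (rule arg_cong[where f = Sum_any]) (auto simp: when_def)
  finally show ?thesis by (simp add: when_def)
qed

lemma lookup_const_mult:
  fixes f :: "'a::comm_ring_1 poly3"
  shows "lookup (single 0 c * f) m = c * lookup f m"
proof (cases m)
  case (fields i j k)
  then show ?thesis using lookup_single_mult[of 0 0 0 c f i j k] by (simp add: zero_prod_def)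
qed

lemma homogI: "(\<And>m. lookup f m \<noteq> 0 \<Longrightarrow> int (mdeg m) = d) \<Longrightarrow> homog d f"
  by (auto simp: homog_def in_keys_iff)

lemma homogD: "homog d f \<Longrightarrow> lookup f m \<noteq> 0 \<Longrightarrow> int (mdeg m) = d"
  by (auto simp: homog_def in_keys_iff)

lemma homog_0 [simp]: "homog d 0"
  by (simp add: homog_def)

lemma homog_add: "homog d f \<Longrightarrow> homog d g \<Longrightarrow> homog d (f + g)"
  by (rule homogI) (metis add_0 homogD lookup_add)

lemma homog_diff: "homog d f \<Longrightarrow> homog d g \<Longrightarrow> homog d (f - g)"
  for f g :: "'a::comm_ring_1 poly3"
  by (rule homogI) (metis diff_0_right homogD lookup_minus)

lemma homog_sum: "(\<And>x. x \<in> A \<Longrightarrow> homog d (f x)) \<Longrightarrow> homog d (\<Sum>x\<in>A. f x)"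
  by (induction A rule: infinite_finite_induct) (auto intro: homog_add)

lemma homog_single: "int (mdeg m) = d \<Longrightarrow> homog d (single m c)"
  by (auto simp: homog_def)

lemma homog_mult:
  fixes f g :: "'a::comm_ring_1 poly3"
  assumes "homog d f" "homog e g"
  shows "homog (d + e) (f * g)"
  unfolding homog_def
proof
  fix m assume "m \<in> Poly_Mapping.keys (f * g)"
  then obtain a b where "m = a + b" "a \<in> Poly_Mapping.keys f" "b \<in> Poly_Mapping.keys g"
    using keys_mult[of f g] by blast
  then show "int (mdeg m) = d + e" using assms by (simp add: homog_def mdeg_add)
qed

lemma homog_power:
  fixes f :: "'a::comm_ring_1 poly3"
  assumes "homog d f"
  shows "homog (int n * d) (f ^ n)"
proof (induction n)
  case 0
  show ?case using homog_single[of 0 0 "1::'a"] by (simp add: mdeg_def)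
next
  case (Suc n)
  then have "homog (d + int n * d) (f * f ^ n)" by (rule homog_mult[OF assms])
  then show ?case by (simp add: algebra_simps)
qed

lemma homog_lin_form: "homog 1 (lin_form a b c)"
  unfolding lin_form_def by (intro homog_add homog_single) (auto simp: mdeg_def)

lemma homog_const_mult: "homog d f \<Longrightarrow> homog d (single 0 c * f)"
  for f :: "'a::comm_ring_1 poly3"
  by (rule homogI) (metis homogD lookup_const_mult mult_zero_right)

lemma homog_neg: "homog d f \<Longrightarrow> d < 0 \<Longrightarrow> f = 0"
  by (rule poly_mapping_eqI) (use homogD in fastforce)

section \<open>Homogeneous components\<close>

definition hpart :: "nat \<Rightarrow> 'a::comm_ring_1 poly3 \<Rightarrow> 'a poly3" where
  "hpart n f = (\<Sum>m | m \<in> Poly_Mapping.keys f \<and> mdeg m = n. single m (lookup f m))"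

lemma lookup_hpart: "lookup (hpart n f) m = (if mdeg m = n then lookup f m else 0)"
proof -
  have "lookup (hpart n f) m
      = (\<Sum>m' | m' \<in> Poly_Mapping.keys f \<and> mdeg m' = n. if m' = m then lookup f m' else 0)"
    unfolding hpart_def lookup_sum by (intro sum.cong) (auto simp: lookup_single when_def)
  also have "\<dots> = (if mdeg m = n then lookup f m else 0)"
    by (subst sum.delta) (auto simp: in_keys_iff)
  finally show ?thesis .
qed

lemma hpart_add: "hpart n (f + g) = hpart n f + hpart n g"
  by (rule poly_mapping_eqI) (simp add: lookup_hpart lookup_add)

lemma hpart_0 [simp]: "hpart n 0 = 0"
  by (rule poly_mapping_eqI) (simp add: lookup_hpart)

lemma hpart_sum: "hpart n (\<Sum>x\<in>A. f x) = (\<Sum>x\<in>A. hpart n (f x))"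
  by (induction A rule: infinite_finite_induct) (auto simp: hpart_add)

lemma homog_hpart: "homog (int n) (hpart n f)"
  by (rule homogI) (auto simp: lookup_hpart split: if_splits)

lemma hpart_homog: "homog (int n) f \<Longrightarrow> hpart n f = f"
  by (rule poly_mapping_eqI) (use homogD in \<open>fastforce simp: lookup_hpart\<close>)

lemma hpart_eq_0: "(\<And>m. m \<in> Poly_Mapping.keys f \<Longrightarrow> mdeg m \<noteq> n) \<Longrightarrow> hpart n f = 0"
  by (rule poly_mapping_eqI) (auto simp: lookup_hpart in_keys_iff)

text \<open>The part of \<open>h\<close> outside degree \<open>n - e\<close> contributes only to
  degrees other than \<open>n\<close>. This makes the coefficients of an ideal relation
  homogeneous.\<close>

lemma hpart_mult_homog:
  fixes h Q :: "'a::comm_ring_1 poly3"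
  assumes "homog (int e) Q"
  shows "hpart n (h * Q) = (if e \<le> n then hpart (n - e) h * Q else 0)"
proof (cases "e \<le> n")
  case True
  have "hpart n ((h - hpart (n - e) h) * Q) = 0"
  proof (rule hpart_eq_0)
    fix m assume "m \<in> Poly_Mapping.keys ((h - hpart (n - e) h) * Q)"
    then obtain a b where ab: "m = a + b" "a \<in> Poly_Mapping.keys (h - hpart (n - e) h)"
      "b \<in> Poly_Mapping.keys Q"
      using keys_mult[of "h - hpart (n - e) h" Q] by blast
    then have "mdeg a \<noteq> n - e" by (auto simp: in_keys_iff lookup_minus lookup_hpart)
    moreover have "mdeg b = e" using ab(3) assms by (auto simp: homog_def)
    ultimately show "mdeg m \<noteq> n" using ab(1) True by (auto simp: mdeg_add)
  qed
  moreover have "hpart n (hpart (n - e) h * Q) = hpart (n - e) h * Q"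
    using homog_mult[OF homog_hpart[of "n - e" h] assms] True
    by (intro hpart_homog) (simp add: of_nat_diff)
  moreover have "h * Q = (h - hpart (n - e) h) * Q + hpart (n - e) h * Q"
    by (simp add: algebra_simps)
  ultimately show ?thesis using True by (metis add_0 hpart_add)
next
  case False
  have "hpart n (h * Q) = 0"
  proof (rule hpart_eq_0)
    fix m assume "m \<in> Poly_Mapping.keys (h * Q)"
    then obtain a b where "m = a + b" "b \<in> Poly_Mapping.keys Q"
      using keys_mult[of h Q] by blast
    then show "mdeg m \<noteq> n" using False assms by (auto simp: homog_def mdeg_add)
  qed
  then show ?thesis using False by simp
qed

section \<open>Monomials of fixed degree\<close>

definition mons :: "nat \<Rightarrow> (nat \<times> nat \<times> nat) set" where
  "mons d = {m. mdeg m = d}"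

lemma finite_mons [simp]: "finite (mons d)"
  by (rule finite_subset[of _ "{..d} \<times> {..d} \<times> {..d}"]) (auto simp: mons_def mdeg_def)

text \<open>Sort the monomials by whether \<open>z^3\<close> divides them. Hence
  \<open>card (coords d)\<close> is the dimension of \<open>[R/L^3]\<close> in degree
  \<open>d\<close> for a nonzero linear form \<open>L\<close>.\<close>

lemma card_mons:
  assumes "3 \<le> d"
  shows "card (mons d) = card (mons (d - 3)) + card (coords d)"
proof -
  let ?f = "\<lambda>(i, j, k). (i, j, k + 3) :: nat \<times> nat \<times> nat"
  let ?g = "\<lambda>(c, b). (d - b - c, b, c) :: nat \<times> nat \<times> nat"
  have "mons d = ?f ` mons (d - 3) \<union> ?g ` coords d"
  proof (intro equalityI subsetI)
    fix m assume m: "m \<in> mons d"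
    obtain i j k where ijk: "m = (i, j, k)" by (cases m)
    show "m \<in> ?f ` mons (d - 3) \<union> ?g ` coords d"
    proof (cases "k \<le> 2")
      case True
      then have "m = ?g (k, j)" "(k, j) \<in> coords d"
        using m ijk by (auto simp: mons_def mdeg_def coords_def)
      then show ?thesis by blast
    next
      case False
      then have "m = ?f (i, j, k - 3)" "(i, j, k - 3) \<in> mons (d - 3)"
        using m ijk by (auto simp: mons_def mdeg_def)
      then show ?thesis by blast
    qed
  qed (use assms in \<open>auto simp: mons_def mdeg_def coords_def\<close>)
  moreover have "?f ` mons (d - 3) \<inter> ?g ` coords d = {}" by (auto simp: coords_def)
  moreover have "card (?f ` mons (d - 3)) = card (mons (d - 3))"
    by (intro card_image) (auto simp: inj_on_def)
  moreover have "card (?g ` coords d) = card (coords d)"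
    by (intro card_image) (auto simp: inj_on_def)
  ultimately show ?thesis by (simp add: card_Un_disjoint)
qed

lemma homog_eq_sum_mons:
  fixes f :: "'a::comm_ring_1 poly3"
  assumes "homog (int d) f"
  shows "f = (\<Sum>m\<in>mons d. single 0 (lookup f m) * single m 1)"
proof (rule poly_mapping_eqI)
  fix m
  have "lookup (\<Sum>m\<in>mons d. single 0 (lookup f m) * single m 1) m
      = (\<Sum>m'\<in>mons d. if m' = m then lookup f m' else 0)"
    unfolding lookup_sum by (intro sum.cong) (auto simp: lookup_const_mult lookup_single when_def)
  also have "\<dots> = lookup f m"
    using homogD[OF assms, of m] by (subst sum.delta[OF finite_mons]) (auto simp: mons_def)
  finally show "lookup f m
      = lookup (\<Sum>m\<in>mons d. single 0 (lookup f m) * single m 1) m" by simp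
qed

lemma lookup_lin_form_mult:
  fixes P :: "'a::comm_ring_1 poly3"
  shows "lookup (lin_form a b c * P) (i, j, k) =
    (if 1 \<le> i then a * lookup P (i - 1, j, k) else 0)
  + (if 1 \<le> j then b * lookup P (i, j - 1, k) else 0)
  + (if 1 \<le> k then c * lookup P (i, j, k - 1) else 0)"
  by (simp add: lin_form_def distrib_right lookup_add lookup_single_mult)

lemma lookup_lin_form_power:
  fixes t u :: "'a::field_char_0"
  shows "lookup (lin_form 1 t u ^ N) (i, j, k) =
    (if i + j + k = N then fact N / (fact i * fact j * fact k) * t ^ j * u ^ k else 0)"
proof (induction N arbitrary: i j k)
  case 0
  show ?case by (auto simp: lookup_one when_def zero_prod_def)
next
  case (Suc N)
  show ?case
  proof (cases "i + j + k = Suc N")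
    case True
    \<comment> \<open>Each of the three predecessors contributes \<open>?M\<close> times the
      exponent that was lowered, and these exponents add up to \<open>Suc N\<close>.\<close>
    let ?M = "fact N / (fact i * fact j * fact k) * t ^ j * u ^ k"
    have i: "(if 1 \<le> i then lookup (lin_form 1 t u ^ N) (i - 1, j, k) else 0) = of_nat i * ?M"
      using True by (cases i) (simp_all add: Suc mult.assoc del: of_nat_Suc)
    have j: "(if 1 \<le> j then t * lookup (lin_form 1 t u ^ N) (i, j - 1, k) else 0) = of_nat j * ?M"
      using True by (cases j) (simp_all add: Suc mult.assoc del: of_nat_Suc)
    have k: "(if 1 \<le> k then u * lookup (lin_form 1 t u ^ N) (i, j, k - 1) else 0) = of_nat k * ?M"
      using True by (cases k) (simp_all add: Suc mult.assoc del: of_nat_Suc)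
    have "lookup (lin_form 1 t u ^ Suc N) (i, j, k) = of_nat (i + j + k) * ?M"
      unfolding power_Suc lookup_lin_form_mult mult_1 i j k by (simp only: of_nat_add distrib_right)
    also have "\<dots> = of_nat (Suc N) * ?M" unfolding True ..
    finally show ?thesis using True by (simp add: fact_Suc)
  qed (auto simp: lookup_lin_form_mult Suc)
qed

subsection \<open>Reduction modulo the cube of a linear form\<close>

text \<open>The index set \<open>c \<le> 2\<close>, \<open>b + c \<le> e\<close> is the set indexed by \<open>jet_index\<close> at a point of
  multiplicity \<open>e + 1\<close>, with \<open>e = d - a\<^sub>i\<close>.\<close>
definition reducible :: "'a::comm_ring_1 poly3 \<Rightarrow> 'a poly3 \<Rightarrow> nat \<Rightarrow> 'a poly3 \<Rightarrow> bool" where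
  "reducible M L e h \<longleftrightarrow> (\<exists>k g. homog (int e - 3) g \<and>
     h = (\<Sum>(c, b)\<in>(SIGMA c:{..2}. {..<e + 1 - c}).
            single 0 (k (c, b)) * (M ^ (e - b - c) * single (0, b, c) 1)) + L ^ 3 * g)"

lemma const_add: "single 0 (a + b) = single 0 a + (single 0 b :: 'a::comm_ring_1 poly3)"
  by (simp add: single_add)

lemma const_mult: "single 0 (a * b) = single 0 a * (single 0 b :: 'a::comm_ring_1 poly3)"
  by (simp add: mult_single)

lemma reducible_add:
  assumes "reducible M L e h" "reducible M L e h'"
  shows "reducible M L e (h + h')"
proof -
  from assms obtain k g k' g' where "homog (int e - 3) g" "homog (int e - 3) g'"
    "h = (\<Sum>(c, b)\<in>(SIGMA c:{..2}. {..<e + 1 - c}).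
            single 0 (k (c, b)) * (M ^ (e - b - c) * single (0, b, c) 1)) + L ^ 3 * g"
    "h' = (\<Sum>(c, b)\<in>(SIGMA c:{..2}. {..<e + 1 - c}).
            single 0 (k' (c, b)) * (M ^ (e - b - c) * single (0, b, c) 1)) + L ^ 3 * g'"
    unfolding reducible_def by blast
  then show ?thesis unfolding reducible_def
    by (intro exI[of _ "\<lambda>x. k x + k' x"] exI[of _ "g + g'"])
      (simp add: homog_add const_add distrib_right distrib_left sum.distrib split_def)
qed

lemma reducible_const_mult:
  assumes "reducible M L e h"
  shows "reducible M L e (single 0 a * h)"
proof -
  from assms obtain k g where "homog (int e - 3) g"
    "h = (\<Sum>(c, b)\<in>(SIGMA c:{..2}. {..<e + 1 - c}).
            single 0 (k (c, b)) * (M ^ (e - b - c) * single (0, b, c) 1)) + L ^ 3 * g"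
    unfolding reducible_def by blast
  then show ?thesis unfolding reducible_def
    by (intro exI[of _ "\<lambda>x. a * k x"] exI[of _ "single 0 a * g"] conjI homog_const_mult)
      (simp_all add: const_mult distrib_left sum_distrib_left split_def mult_ac)
qed

lemma reducible_ideal: "homog (int e - 3) g \<Longrightarrow> reducible M L e (L ^ 3 * g)"
  unfolding reducible_def by (intro exI[of _ "\<lambda>_. 0"] exI[of _ g]) simp

lemma reducible_0 [simp]: "reducible M L e 0"
  using reducible_ideal[of e 0 M L] by simp

lemma reducible_sum: "(\<And>x. x \<in> A \<Longrightarrow> reducible M L e (f x)) \<Longrightarrow> reducible M L e (\<Sum>x\<in>A. f x)"
  by (induction A rule: infinite_finite_induct) (auto intro: reducible_add)

lemma reducible_diff:
  assumes "reducible M L e h" "reducible M L e h'"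
  shows "reducible M L e (h - h')"
proof -
  have "single 0 (-1) * h' = - h'"
    by (metis mult_minus1 single_one single_uminus)
  then show ?thesis
    using reducible_add[OF assms(1) reducible_const_mult[OF assms(2), of "-1"]] by simp
qed

lemma reducible_generator:
  fixes M L :: "'a::comm_ring_1 poly3"
  assumes "c \<le> 2" "n + b + c = e"
  shows "reducible M L e (M ^ n * single (0, b, c) 1)"
proof -
  let ?S = "SIGMA c:{..2}. {..<e + 1 - c}"
  let ?G = "\<lambda>x. M ^ (e - snd x - fst x) * single (0, snd x, fst x) 1"
  define k :: "nat \<times> nat \<Rightarrow> 'a" where "k = (\<lambda>x. if x = (c, b) then 1 else 0)"
  have "(\<Sum>(c, b)\<in>?S. single 0 (k (c, b)) * (M ^ (e - b - c) * single (0, b, c) 1))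
      = (\<Sum>x\<in>?S. if x = (c, b) then ?G x else 0)"
    by (intro sum.cong) (auto simp: k_def split: if_splits)
  also have "\<dots> = ?G (c, b)" using assms by (subst sum.delta) auto
  also have "\<dots> = M ^ n * single (0, b, c) 1" using assms by auto
  finally show ?thesis unfolding reducible_def
    by (intro exI[of _ k] exI[of _ 0]) simp
qed

text \<open>Expand \<open>L^3\<close> in \<open>M\<close>, \<open>y\<close>, \<open>z\<close>: all
  terms but \<open>r^3 z^3\<close> have exponent of \<open>z\<close> at most 2, so dividing by
  \<open>r^3\<close> rewrites \<open>z^3\<close> modulo \<open>L^3\<close>.\<close>

lemma reducible_cube:
  assumes L: "L = single 0 p * M + single 0 q * single (0, 1, 0) 1 + single 0 r * single (0, 0, 1) 1"
    and r: "r \<noteq> (0::'a::field_char_0)" and M: "homog 1 M" and e: "n + b + 3 = e"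
  shows "reducible M L e (M ^ n * single (0, b, 3) 1)"
proof -
  let ?C = "\<lambda>x. single 0 x :: 'a poly3"
  let ?g = "\<lambda>n b c. M ^ n * single (0, b, c) 1"
  define Y Z where "Y = (single (0, 1, 0) 1 :: 'a poly3)" and "Z = (single (0, 0, 1) 1 :: 'a poly3)"
  define B where "B = (single (0, b, 0) 1 :: 'a poly3)"
  have YZ: "single (0, b + 1, 0) 1 = B * Y" "single (0, b + 2, 0) 1 = B * Y ^ 2" "single (0, b + 3, 0) 1 = B * Y ^ 3"
    "single (0, b, 1) 1 = B * Z" "single (0, b, 2) 1 = B * Z ^ 2" "single (0, b, 3) 1 = B * Z ^ 3"
    "single (0, b + 1, 1) 1 = B * Y * Z" "single (0, b + 1, 2) 1 = B * Y * Z ^ 2"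
    "single (0, b + 2, 1) 1 = B * Y ^ 2 * Z"
    by (simp_all add: B_def Y_def Z_def mult_single eval_nat_numeral)
  have three: "?C 3 = 3" "?C 6 = 6" by (simp_all add: single_numeral)
  have pw: "?C (x ^ 2) = ?C x ^ 2" "?C (x ^ 3) = ?C x ^ 3" for x
    by (simp_all add: power2_eq_square power3_eq_cube const_mult)
  have "?C (r ^ 3) * ?g n b 3 = L ^ 3 * ?g n b 0
      - (?C (p ^ 3) * ?g (n + 3) b 0 + ?C (3 * p ^ 2 * q) * ?g (n + 2) (b + 1) 0
        + ?C (3 * p * q ^ 2) * ?g (n + 1) (b + 2) 0 + ?C (q ^ 3) * ?g n (b + 3) 0
        + ?C (3 * p ^ 2 * r) * ?g (n + 2) b 1 + ?C (6 * p * q * r) * ?g (n + 1) (b + 1) 1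
        + ?C (3 * q ^ 2 * r) * ?g n (b + 2) 1
        + ?C (3 * p * r ^ 2) * ?g (n + 1) b 2 + ?C (3 * q * r ^ 2) * ?g n (b + 1) 2)"
    unfolding YZ B_def[symmetric] L Y_def[symmetric] Z_def[symmetric] const_mult pw three
    by (simp add: power_add power2_eq_square power3_eq_cube algebra_simps)
  moreover have "reducible M L e (\<dots>)"
  proof (intro reducible_diff reducible_add reducible_const_mult reducible_generator reducible_ideal)
    have "homog (int n * 1 + int b) (?g n b 0)"
      using M by (intro homog_mult homog_power homog_single) (auto simp: mdeg_def)
    then show "homog (int e - 3) (?g n b 0)" using e by (simp add: algebra_simps flip: e)
  qed (use e in auto)
  ultimately have "reducible M L e (?C (1 / r ^ 3) * (?C (r ^ 3) * ?g n b 3))"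
    by (metis reducible_const_mult)
  moreover have "?C (1 / r ^ 3) * (?C (r ^ 3) * ?g n b 3) = ?g n b 3"
    using r by (simp add: mult_single flip: mult.assoc)
  ultimately show ?thesis by simp
qed

text \<open>The summand \<open>L^3 * g\<close> is carried along, so multiplication by
  \<open>W\<close> need only be checked on the spanning products.\<close>

lemma reducible_mult:
  assumes "homog 1 W" "reducible M L e h"
    and "\<And>c b n. c \<le> 2 \<Longrightarrow> n + b + c = e \<Longrightarrow> reducible M L (e + 1) (W * (M ^ n * single (0, b, c) 1))"
  shows "reducible M L (e + 1) (W * h)"
proof -
  from assms(2) obtain k g where g: "homog (int e - 3) g"
    and h: "h = (\<Sum>(c, b)\<in>(SIGMA c:{..2}. {..<e + 1 - c}).
            single 0 (k (c, b)) * (M ^ (e - b - c) * single (0, b, c) 1)) + L ^ 3 * g"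
    unfolding reducible_def by blast
  have "W * h = (\<Sum>(c, b)\<in>(SIGMA c:{..2}. {..<e + 1 - c}).
            single 0 (k (c, b)) * (W * (M ^ (e - b - c) * single (0, b, c) 1))) + L ^ 3 * (W * g)"
    by (simp add: h distrib_left sum_distrib_left split_def mult_ac)
  moreover have "homog (int (e + 1) - 3) (W * g)"
    using homog_mult[OF assms(1) g] by (simp add: algebra_simps)
  moreover have "reducible M L (e + 1) (case x of (c, b) \<Rightarrow>
      single 0 (k (c, b)) * (W * (M ^ (e - b - c) * single (0, b, c) 1)))"
    if "x \<in> (SIGMA c:{..2}. {..<e + 1 - c})" for x
  proof -
    obtain c b where x: "x = (c, b)" by (cases x)
    then have "c \<le> 2" "e - b - c + b + c = e" using that by auto
    then show ?thesis unfolding x prod.case by (intro reducible_const_mult assms(3))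
  qed
  ultimately show ?thesis
    by (simp only:) (intro reducible_add reducible_sum reducible_ideal)
qed

lemma lin_form_eq: "lin_form \<alpha> \<beta> \<gamma> = single 0 \<alpha> * single (1, 0, 0) 1
    + single 0 \<beta> * single (0, 1, 0) 1 + single 0 \<gamma> * single (0, 0, 1) (1::'a::comm_ring_1)"
  by (simp add: lin_form_def mult_single)

text \<open>With \<open>\<alpha> \<noteq> 0\<close> the form \<open>?M\<close> replaces
  \<open>x\<close> as a coordinate, and \<open>det\<close> says that \<open>z\<close> occurs in
  \<open>?L\<close> written in \<open>?M\<close>, \<open>y\<close>, \<open>z\<close>. Monomials are
  built up factor by factor, with \<open>reducible_cube\<close> removing \<open>z^3\<close>.\<close>

lemma homog_reducible:
  fixes \<alpha> :: "'a::field_char_0"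
  assumes \<alpha>: "\<alpha> \<noteq> 0" and det: "c * \<alpha> - a * \<gamma> \<noteq> 0"
    and h: "homog (int e) h"
  shows "reducible (lin_form \<alpha> \<beta> \<gamma>) (lin_form a b c) e h"
proof -
  let ?M = "lin_form \<alpha> \<beta> \<gamma>" and ?L = "lin_form a b c"
  let ?X = "single (1, 0, 0) 1 :: 'a poly3"
  let ?Y = "single (0, 1, 0) 1 :: 'a poly3" and ?Z = "single (0, 0, 1) 1 :: 'a poly3"
  let ?C = "\<lambda>x. single 0 x :: 'a poly3"
  have X: "?X = ?C (1 / \<alpha>) * (?M - ?C \<beta> * ?Y - ?C \<gamma> * ?Z)"
    using \<alpha> by (simp add: lin_form_eq mult_single)
  have "?L = ?C (a / \<alpha>) * ?M + ?C (b - a * \<beta> / \<alpha>) * ?Y + ?C (c - a * \<gamma> / \<alpha>) * ?Z"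
    using \<alpha> by (simp add: lin_form_def distrib_left mult_single flip: single_add)
      (simp add: single_diff algebra_simps)
  note cube = reducible_cube[OF this _ homog_lin_form]
  have r: "c - a * \<gamma> / \<alpha> \<noteq> 0" using \<alpha> det by (simp add: field_simps)
  have red_M: "reducible ?M ?L (e + 1) (?M * h)" if "reducible ?M ?L e h" for e h
  proof (rule reducible_mult[OF homog_lin_form that])
    fix c b n assume "c \<le> 2" "n + b + c = e"
    then show "reducible ?M ?L (e + 1) (?M * (?M ^ n * single (0, b, c) 1))"
      using reducible_generator[of c "n + 1" b "e + 1" ?M ?L] by (simp add: mult.assoc)
  qed
  have red_Y: "reducible ?M ?L (e + 1) (?Y * h)" if "reducible ?M ?L e h" for e h
  proof (rule reducible_mult[OF _ that])
    show "homog 1 ?Y" by (rule homog_single) (simp add: mdeg_def)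
    fix c b n assume *: "c \<le> 2" "n + b + c = e"
    have "?Y * (?M ^ n * single (0, b, c) 1) = ?M ^ n * single (0, b + 1, c) 1"
      by (simp add: mult.left_commute mult_single)
    then show "reducible ?M ?L (e + 1) (?Y * (?M ^ n * single (0, b, c) 1))"
      using reducible_generator[of c n "b + 1" "e + 1" ?M ?L] * by simp
  qed
  have red_Z: "reducible ?M ?L (e + 1) (?Z * h)" if "reducible ?M ?L e h" for e h
  proof (rule reducible_mult[OF _ that])
    show "homog 1 ?Z" by (rule homog_single) (simp add: mdeg_def)
    fix c b n assume *: "c \<le> 2" "n + b + c = e"
    have eq: "?Z * (?M ^ n * single (0, b, c) 1) = ?M ^ n * single (0, b, c + 1) 1"
      by (simp add: mult.left_commute mult_single)
    show "reducible ?M ?L (e + 1) (?Z * (?M ^ n * single (0, b, c) 1))"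
    proof (cases "c = 2")
      case True
      then have "n + b + 3 = e + 1" using * by simp
      from cube[OF r this] show ?thesis unfolding eq using True by simp
    next
      case False
      then show ?thesis unfolding eq using * by (intro reducible_generator) auto
    qed
  qed
  have red_X: "reducible ?M ?L (e + 1) (?X * h)" if "reducible ?M ?L e h" for e h
  proof -
    have "?X * h = ?C (1 / \<alpha>) * (?M * h - ?C \<beta> * (?Y * h) - ?C \<gamma> * (?Z * h))"
      by (subst X) (simp only: left_diff_distrib mult.assoc)
    then show ?thesis
      using red_M[OF that] red_Y[OF that] red_Z[OF that]
      by (simp only:) (intro reducible_const_mult reducible_diff; assumption)
  qed
  have "reducible ?M ?L (mdeg m) (single m 1)" for m
  proof (induction "mdeg m" arbitrary: m)
    case 0
    then have "m = 0" by (cases m) (auto simp: mdeg_def zero_prod_def)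
    then show ?case
      using reducible_generator[of 0 0 0 0 ?M ?L] by (simp add: mdeg_def zero_prod_def)
  next
    case (Suc d)
    obtain i j k where m: "m = (i, j, k)" by (cases m)
    consider i' where "i = i' + 1" | j' where "j = j' + 1" | k' where "k = k' + 1"
      using Suc.hyps(2) m by (cases i; cases j; cases k) (auto simp: mdeg_def)
    then show ?case
    proof cases
      case 1
      then have "reducible ?M ?L d (single (i', j, k) 1)"
        using Suc.hyps(1)[of "(i', j, k)"] Suc.hyps(2) m by (auto simp: mdeg_def)
      from red_X[OF this] show ?thesis using Suc.hyps(2) m 1 by (simp add: mult_single)
    next
      case 2
      then have "reducible ?M ?L d (single (i, j', k) 1)"
        using Suc.hyps(1)[of "(i, j', k)"] Suc.hyps(2) m by (auto simp: mdeg_def)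
      from red_Y[OF this] show ?thesis using Suc.hyps(2) m 2 by (simp add: mult_single)
    next
      case 3
      then have "reducible ?M ?L d (single (i, j, k') 1)"
        using Suc.hyps(1)[of "(i, j, k')"] Suc.hyps(2) m by (auto simp: mdeg_def)
      from red_Z[OF this] show ?thesis using Suc.hyps(2) m 3 by (simp add: mult_single)
    qed
  qed
  then have "reducible ?M ?L e (\<Sum>m\<in>mons e. single 0 (lookup h m) * single m 1)"
    by (intro reducible_sum reducible_const_mult) (auto simp: mons_def)
  then show ?thesis using homog_eq_sum_mons[OF h] by simp
qed

subsection \<open>The multiplication map as a matrix\<close>

text \<open>Restricting to \<open>c \<le> 2\<close> discards the trivial syzygies between \<open>L\<^sup>3\<close> and the powers of the
  \<open>M i\<close>, so that these columns can be independent.\<close>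
definition columns ::
  "nat \<Rightarrow> 'a::comm_ring_1 poly3 \<Rightarrow> (nat \<Rightarrow> 'a poly3) \<Rightarrow> (nat \<times> nat \<times> nat) + (nat \<times> nat \<times> nat) \<Rightarrow> 'a poly3" where
  "columns d L M = case_sum (\<lambda>m. L ^ 3 * single m 1) (\<lambda>(i, c, b). M i ^ (d - b - c) * single (0, b, c) 1)"

lemma columns_simps [simp]:
  "columns d L M (Inl m) = L ^ 3 * single m 1"
  "columns d L M (Inr (i, c, b)) = M i ^ (d - b - c) * single (0, b, c) 1"
  by (simp_all add: columns_def)

lemma homog_columns:
  assumes "3 \<le> d" "x \<in> mons (d - 3) <+> jet_index m I" "\<And>i. i \<in> I \<Longrightarrow> m i \<le> d + 1"
    and "homog 1 L" "\<And>i. i \<in> I \<Longrightarrow> homog 1 (M i)"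
  shows "homog (int d) (columns d L M x)"
proof -
  consider (Inl) \<mu> where "x = Inl \<mu>" "\<mu> \<in> mons (d - 3)"
    | (Inr) y where "x = Inr y" "y \<in> jet_index m I"
    using assms(2) by auto
  then show ?thesis
  proof cases
  case Inl
  have "homog (int 3 * 1 + int (d - 3)) (L ^ 3 * single \<mu> 1)"
    using Inl by (intro homog_mult homog_power assms(4) homog_single) (auto simp: mons_def)
  then show ?thesis using Inl assms(1) by (simp add: of_nat_diff)
next
  case Inr
  obtain i c b where y: "y = (i, c, b)" by (cases y)
  then have icb: "i \<in> I" "c \<le> 2" "b < m i - c" using Inr by (auto simp: jet_index_def)
  then have "b + c \<le> d" using assms(3)[of i] by linarith
  have "homog (int (d - b - c) * 1 + int (b + c)) (M i ^ (d - b - c) * single (0, b, c) 1)"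
    by (intro homog_mult homog_power assms(5) icb homog_single) (auto simp: mdeg_def)
  then show ?thesis using Inr y \<open>b + c \<le> d\<close> by (simp add: of_nat_diff)
  qed
qed

text \<open>Since \<open>L = z\<close>, the columns with factor \<open>L^3\<close> vanish in all
  coordinates with exponent of \<open>z\<close> at most 2, where the other columns form the matrix
  of \<open>jet_row\<close> up to factorials. This is apolarity in coordinates.\<close>

lemma columns_independent:
  fixes t u :: "nat \<Rightarrow> 'a::field_char_0"
  assumes d: "3 \<le> d" and I: "finite I" "\<And>i. i \<in> I \<Longrightarrow> m i \<le> d + 1"
    and indep: "indep_family (jet_index m I) (coords d) (\<lambda>(i, cb). jet_row (t i) (u i) cb)"
  shows "indep_family (mons (d - 3) <+> jet_index m I) (mons d)
           (\<lambda>x. lookup (columns d (lin_form 0 0 1) (\<lambda>i. lin_form 1 (t i) (u i)) x))"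
  unfolding indep_family_def
proof (intro allI impI)
  let ?Z = "lin_form 0 0 1 :: 'a poly3" and ?M = "\<lambda>i. lin_form 1 (t i) (u i)"
  fix k
  assume k: "\<forall>\<nu>\<in>mons d. (\<Sum>x\<in>mons (d - 3) <+> jet_index m I. k x * lookup (columns d ?Z ?M x) \<nu>) = 0"
  have Z3: "?Z ^ 3 = single (0, 0, 3) 1"
    by (simp add: lin_form_def mult_single eval_nat_numeral)
  have split: "(\<Sum>\<mu>\<in>mons (d - 3). k (Inl \<mu>) * lookup (single (0, 0, 3) 1 * single \<mu> 1) \<nu>)
      + (\<Sum>(i, c, b)\<in>jet_index m I. k (Inr (i, c, b)) * lookup (?M i ^ (d - b - c) * single (0, b, c) 1) \<nu>) = 0"
    if "\<nu> \<in> mons d" for \<nu>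
    using k[rule_format, OF that] I by (simp add: sum.Plus Z3 split_def columns_def)
  \<comment> \<open>Scaling the columns by these factorials and the rows by \<open>?w\<close> turns
    multinomial coefficients into products of two binomial coefficients.\<close>
  define k' where "k' = (\<lambda>(i, c, b). k (Inr (i, c, b)) * (fact (d - b - c) * fact b * fact c))"
  have "\<forall>x\<in>jet_index m I. k' x = 0"
  proof
    fix x assume x: "x \<in> jet_index m I"
    show "k' x = 0"
    proof (rule indep_familyD[OF indep _ x])
      fix y assume y: "y \<in> coords d"
      obtain c' b' where y': "y = (c', b')" "c' \<le> 2" "b' \<le> d - c'"
        using y by (auto simp: coords_def)
      let ?\<nu> = "(d - b' - c', b', c')"
      let ?w = "fact b' * fact c' * fact (d - b' - c') :: 'a"
      have \<nu>: "?\<nu> \<in> mons d" using y' d by (auto simp: mons_def mdeg_def)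
      have "lookup (single (0, 0, 3) 1 * single \<mu> (1::'a)) ?\<nu> = 0" for \<mu>
        using y' by (simp add: lookup_single_mult)
      then have "0 = ?w * (\<Sum>(i, c, b)\<in>jet_index m I.
          k (Inr (i, c, b)) * lookup (?M i ^ (d - b - c) * single (0, b, c) 1) ?\<nu>)"
        using split[OF \<nu>] by simp
      also have "\<dots> = (\<Sum>x\<in>jet_index m I. k' x * (case x of (i, cb) \<Rightarrow> jet_row (t i) (u i) cb) y)"
        unfolding sum_distrib_left
      proof (intro sum.cong refl)
        fix x assume x: "x \<in> jet_index m I"
        obtain i c b where icb: "x = (i, c, b)" "i \<in> I" "c \<le> 2" "b < m i - c"
          using x by (auto simp: jet_index_def)
        have bc: "b + c \<le> d" using icb I(2)[of i] by linarith
        show "?w * (case x of (i, c, b) \<Rightarrow>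
            k (Inr (i, c, b)) * lookup (?M i ^ (d - b - c) * single (0, b, c) 1) ?\<nu>)
          = k' x * (case x of (i, cb) \<Rightarrow> jet_row (t i) (u i) cb) y"
        proof (cases "b \<le> b' \<and> c \<le> c'")
          case True
          then have binom: "(of_nat (b' choose b) :: 'a) = fact b' / (fact b * fact (b' - b))"
            "(of_nat (c' choose c) :: 'a) = fact c' / (fact c * fact (c' - c))"
            by (simp_all add: binomial_fact)
          have "d - b' - c' + (b' - b) + (c' - c) = d - b - c" using True y' d by auto
          then have "lookup (?M i ^ (d - b - c) * single (0, b, c) 1) ?\<nu>
              = fact (d - b - c) / (fact (d - b' - c') * fact (b' - b) * fact (c' - c))
                * t i ^ (b' - b) * u i ^ (c' - c)"
            using True by (subst mult.commute) (simp add: lookup_single_mult lookup_lin_form_power)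
          then show ?thesis
            by (simp add: icb(1) y'(1) k'_def jet_row_def binom mult_ac)
        next
          case False
          then have "lookup (?M i ^ (d - b - c) * single (0, b, c) 1) ?\<nu> = 0"
            by (subst mult.commute) (auto simp: lookup_single_mult)
          moreover have "jet_row (t i) (u i) (c, b) y = 0"
            using False by (auto simp: y'(1) jet_row_def binomial_eq_0)
          ultimately show ?thesis by (simp add: icb(1))
        qed
      qed
      finally show "(\<Sum>x\<in>jet_index m I. k' x * (case x of (i, cb) \<Rightarrow> jet_row (t i) (u i) cb) y) = 0"
        by simp
    qed
  qed
  then have Inr: "k (Inr x) = 0" if "x \<in> jet_index m I" for x
    using that by (cases x) (force simp: k'_def)
  \<comment> \<open>With the power columns gone, the remaining columns are distinct monomials
    divisible by \<open>z^3\<close>.\<close>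
  have Inl: "k (Inl \<mu>) = 0" if \<mu>: "\<mu> \<in> mons (d - 3)" for \<mu>
  proof -
    obtain i j l where ijl: "\<mu> = (i, j, l)" by (cases \<mu>)
    let ?\<nu> = "(i, j, l + 3)"
    have \<nu>: "?\<nu> \<in> mons d" using \<mu> d by (auto simp: ijl mons_def mdeg_def)
    have "(\<Sum>(i, c, b)\<in>jet_index m I.
        k (Inr (i, c, b)) * lookup (?M i ^ (d - b - c) * single (0, b, c) 1) ?\<nu>) = 0"
      using Inr by (intro sum.neutral) auto
    moreover have "(\<Sum>\<mu>'\<in>mons (d - 3). k (Inl \<mu>') * lookup (single (0, 0, 3) 1 * single \<mu>' 1) ?\<nu>)
        = (\<Sum>\<mu>'\<in>mons (d - 3). if \<mu>' = \<mu> then k (Inl \<mu>') else 0)"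
      by (intro sum.cong refl) (auto simp: lookup_single_mult lookup_single when_def ijl)
    ultimately show ?thesis using split[OF \<nu>] \<mu> by (simp add: sum.delta)
  qed
  show "\<forall>x\<in>mons (d - 3) <+> jet_index m I. k x = 0" using Inl Inr by auto
qed

lemma polyfun_lin_form_power_mult:
  assumes "polyfun n a" "polyfun n b" "polyfun n c" "\<And>m. polyfun n (\<lambda>v. lookup (P v) m)"
  shows "polyfun n (\<lambda>v. lookup (lin_form (a v) (b v) (c v) ^ e * P v) m)"
proof (induction e arbitrary: m)
  case 0
  then show ?case using assms(4) by simp
next
  case (Suc e)
  obtain i j k where m: "m = (i, j, k)" by (cases m)
  have *: "polyfun n (\<lambda>v. if C then f v * lookup (lin_form (a v) (b v) (c v) ^ e * P v) m' else 0)"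
    if "polyfun n f" for C f m'
    using pf_mult[OF that Suc[of m']] by (cases C) (simp_all add: pf_const)
  show ?case
    unfolding m power_Suc mult.assoc lookup_lin_form_mult
    by (intro pf_add *[OF assms(1)] *[OF assms(2)] *[OF assms(3)])
qed

section \<open>From independent columns to surjectivity and injectivity\<close>

lemma ideal_genI: "(\<Sum>i<s. h i * g i) \<in> ideal_gen s g"
  by (auto simp: ideal_gen_def)

lemma ideal_gen_generator:
  fixes g :: "nat \<Rightarrow> 'a::comm_ring_1 poly3"
  assumes "i < s"
  shows "h * g i \<in> ideal_gen s g"
proof -
  have "(\<Sum>j<s. (if j = i then h else 0) * g j) = (\<Sum>j<s. if j = i then h * g j else 0)"
    by (intro sum.cong) auto
  also have "\<dots> = h * g i" using assms by (subst sum.delta) auto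
  finally show ?thesis using ideal_genI[of "\<lambda>j. if j = i then h else 0" g s] by simp
qed

lemma ideal_gen_add:
  assumes "x \<in> ideal_gen s g" "y \<in> ideal_gen s g"
  shows "x + y \<in> ideal_gen s g"
proof -
  from assms obtain h h' where "x = (\<Sum>i<s. h i * g i)" "y = (\<Sum>i<s. h' i * g i)"
    by (auto simp: ideal_gen_def)
  then have "x + y = (\<Sum>i<s. (h i + h' i) * g i)" by (simp add: distrib_right sum.distrib)
  then show ?thesis by (simp only: ideal_genI)
qed

lemma ideal_gen_sum:
  assumes "\<And>x. x \<in> A \<Longrightarrow> f x \<in> ideal_gen s g"
  shows "(\<Sum>x\<in>A. f x) \<in> ideal_gen s g"
proof -
  have "0 \<in> ideal_gen s g" using ideal_genI[of "\<lambda>_. 0" g s] by simp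
  then show ?thesis using assms
    by (induction A rule: infinite_finite_induct) (auto intro: ideal_gen_add)
qed

text \<open>The count makes the columns a basis in degree \<open>d\<close>. In the expansion of
  \<open>h\<close>, the first block is a multiple of \<open>L^3\<close> and the second lies in the
  ideal.\<close>

lemma mult_surj_of_columns:
  fixes L :: "'a::field_char_0 poly3"
  assumes d: "3 \<le> d" and I: "I \<subseteq> {i. i < s \<and> a i \<le> d}"
    and indep: "indep_family (mons (d - 3) <+> jet_index (\<lambda>i. d + 1 - a i) I) (mons d)
           (\<lambda>x. lookup (columns d L M x))"
    and card: "card (jet_index (\<lambda>i. d + 1 - a i) I) = card (coords d)"
    and hom: "homog 1 L" "\<And>i. homog 1 (M i)"
  shows "mult_surj (ideal_gen s (\<lambda>i. M i ^ a i)) (L ^ 3) (int d - 3) (int d)"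
  unfolding mult_surj_def
proof (intro allI impI)
  fix h :: "'a poly3" assume h: "homog (int d) h"
  let ?m = "\<lambda>i. d + 1 - a i"
  let ?J = "mons (d - 3) <+> jet_index ?m I"
  have fin: "finite I" using I finite_subset[of I "{..<s}"] by auto
  have "card ?J = card (mons d)" using fin card card_mons[OF d] by (simp add: card_Plus)
  with indep_family_spans[OF indep, of "lookup h"] fin
  obtain k where k: "\<And>\<nu>. \<nu> \<in> mons d \<Longrightarrow> (\<Sum>x\<in>?J. k x * lookup (columns d L M x) \<nu>) = lookup h \<nu>"
    by auto
  have "h = (\<Sum>x\<in>?J. single 0 (k x) * columns d L M x)"
  proof (rule poly_mapping_eqI)
    fix \<nu>
    have hom_sum: "homog (int d) (\<Sum>x\<in>?J. single 0 (k x) * columns d L M x)"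
      by (intro homog_sum homog_const_mult homog_columns[OF d]) (use hom in auto)
    show "lookup h \<nu> = lookup (\<Sum>x\<in>?J. single 0 (k x) * columns d L M x) \<nu>"
    proof (cases "\<nu> \<in> mons d")
      case True
      then show ?thesis using k by (simp add: lookup_sum lookup_const_mult)
    next
      case False
      then have "lookup h \<nu> = 0" "lookup (\<Sum>x\<in>?J. single 0 (k x) * columns d L M x) \<nu> = 0"
        using homogD[OF h, of \<nu>] homogD[OF hom_sum, of \<nu>] by (auto simp: mons_def)
      then show ?thesis by simp
    qed
  qed
  also have "\<dots> = (\<Sum>\<mu>\<in>mons (d - 3). single 0 (k (Inl \<mu>)) * columns d L M (Inl \<mu>))
      + (\<Sum>x\<in>jet_index ?m I. single 0 (k (Inr x)) * columns d L M (Inr x))"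
    using fin by (simp add: sum.Plus)
  also have "(\<Sum>\<mu>\<in>mons (d - 3). single 0 (k (Inl \<mu>)) * columns d L M (Inl \<mu>))
      = L ^ 3 * (\<Sum>\<mu>\<in>mons (d - 3). single 0 (k (Inl \<mu>)) * single \<mu> 1)"
    by (simp add: sum_distrib_left mult.left_commute)
  finally have "h - L ^ 3 * (\<Sum>\<mu>\<in>mons (d - 3). single 0 (k (Inl \<mu>)) * single \<mu> 1)
      = (\<Sum>x\<in>jet_index ?m I. single 0 (k (Inr x)) * columns d L M (Inr x))" by simp
  also have "\<dots> \<in> ideal_gen s (\<lambda>i. M i ^ a i)"
  proof (rule ideal_gen_sum)
    fix x assume x: "x \<in> jet_index ?m I"
    obtain i c b where icb: "x = (i, c, b)" "i \<in> I" "b < ?m i - c"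
      using x by (auto simp: jet_index_def)
    then have i: "i < s" "a i \<le> d" using I by auto
    \<comment> \<open>The bound \<open>b + c < d + 1 - a i\<close> says that the exponent
      \<open>d - b - c\<close> is at least \<open>a i\<close>.\<close>
    have "d - b - c = d - b - c - a i + a i" using icb i by linarith
    then have "M i ^ (d - b - c) = M i ^ (d - b - c - a i) * M i ^ a i" by (metis power_add)
    then have "single 0 (k (Inr x)) * columns d L M (Inr x)
        = (single 0 (k (Inr x)) * (M i ^ (d - b - c - a i) * single (0, b, c) 1)) * M i ^ a i"
      unfolding icb(1) columns_simps by (simp only: mult_ac)
    then show "single 0 (k (Inr x)) * columns d L M (Inr x) \<in> ideal_gen s (\<lambda>i. M i ^ a i)"
      by (simp only: ideal_gen_generator[OF i(1), where g = "\<lambda>i. M i ^ a i"])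
  qed
  finally have "h - L ^ 3 * (\<Sum>\<mu>\<in>mons (d - 3). single 0 (k (Inl \<mu>)) * single \<mu> 1)
      \<in> ideal_gen s (\<lambda>i. M i ^ a i)" .
  moreover have "homog (int d - 3) (\<Sum>\<mu>\<in>mons (d - 3). single 0 (k (Inl \<mu>)) * single \<mu> 1)"
    using d by (intro homog_sum homog_const_mult homog_single) (auto simp: mons_def)
  ultimately show "\<exists>f. homog (int d - 3) f \<and> h - L ^ 3 * f \<in> ideal_gen s (\<lambda>i. M i ^ a i)"
    by blast
qed

text \<open>Reduce the coefficients of a relation for \<open>L^3 * f\<close> modulo
  \<open>L^3\<close>. Moving the multiples of \<open>L^3\<close> to the left replaces
  \<open>f\<close> by some \<open>f'\<close> congruent to it modulo the ideal, and independence
  forces \<open>f' = 0\<close>.\<close>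

lemma mult_inj_of_columns:
  fixes L :: "'a::field_char_0 poly3"
  assumes d: "3 \<le> d"
    and indep: "indep_family (mons (d - 3) <+> jet_index (\<lambda>i. d + 1 - a i) {i. i < s \<and> a i \<le> d}) (mons d)
           (\<lambda>x. lookup (columns d L M x))"
    and red: "\<And>i e h. i < s \<Longrightarrow> homog (int e) h \<Longrightarrow> reducible (M i) L e h"
    and hom: "homog 1 L" "\<And>i. homog 1 (M i)"
  shows "mult_inj (ideal_gen s (\<lambda>i. M i ^ a i)) (L ^ 3) (int d - 3)"
  unfolding mult_inj_def
proof (intro allI impI)
  fix f assume f: "homog (int d - 3) f" and "L ^ 3 * f \<in> ideal_gen s (\<lambda>i. M i ^ a i)"
  then obtain h where h: "L ^ 3 * f = (\<Sum>i<s. h i * M i ^ a i)" by (auto simp: ideal_gen_def)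
  let ?m = "\<lambda>i. d + 1 - a i"
  define I where "I = {i. i < s \<and> a i \<le> d}"
  have fin: "finite I" by (simp add: I_def)
  let ?J = "mons (d - 3) <+> jet_index ?m I"
  let ?S = "\<lambda>i. SIGMA c:{..2}. {..<?m i - c}"
  have hL: "homog (int 3) (L ^ 3)" using homog_power[OF hom(1), of 3] by simp
  have hM: "homog (int n) (M i ^ n)" for i n using homog_power[OF hom(2), of n] by simp
  have "homog (int d) (L ^ 3 * f)" using homog_mult[OF hL f] by simp
  \<comment> \<open>Comparing parts of degree \<open>d\<close> leaves only generators with
    \<open>a i \<le> d\<close>, with homogeneous coefficients.\<close>
  then have "L ^ 3 * f = hpart d (L ^ 3 * f)" by (rule hpart_homog[symmetric])
  also have "\<dots> = (\<Sum>i<s. if a i \<le> d then hpart (d - a i) (h i) * M i ^ a i else 0)"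
    unfolding h hpart_sum by (intro sum.cong refl) (simp add: hpart_mult_homog[OF hM])
  also have "\<dots> = (\<Sum>i\<in>I. hpart (d - a i) (h i) * M i ^ a i)"
    unfolding I_def by (rule sum.mono_neutral_cong_right) auto
  finally have Lf: "L ^ 3 * f = (\<Sum>i\<in>I. hpart (d - a i) (h i) * M i ^ a i)" .
  define P where "P = (\<lambda>i k g. homog (int (d - a i) - 3) g \<and> hpart (d - a i) (h i)
      = (\<Sum>(c, b)\<in>?S i. single 0 (k (c, b)) * (M i ^ (d - a i - b - c) * single (0, b, c) 1)) + L ^ 3 * g)"
  have "\<exists>k g. P i k g" if "i \<in> I" for i
  proof -
    have i: "i < s" "d - a i + 1 = d + 1 - a i" using that by (auto simp: I_def)
    from red[OF i(1) homog_hpart, of "d - a i" "h i"] show ?thesis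
      unfolding reducible_def i(2) P_def .
  qed
  then have "\<forall>i\<in>I. \<exists>k g. P i k g" by blast
  from bchoice[OF this] obtain k where "\<forall>i\<in>I. \<exists>g. P i (k i) g" ..
  from bchoice[OF this] obtain g where Pkg: "\<forall>i\<in>I. P i (k i) (g i)" ..
  have g: "homog (int (d - a i) - 3) (g i)"
    and hk: "hpart (d - a i) (h i) = (\<Sum>(c, b)\<in>?S i. single 0 (k i (c, b)) *
      (M i ^ (d - a i - b - c) * single (0, b, c) 1)) + L ^ 3 * g i" if "i \<in> I" for i
    using Pkg that unfolding P_def by blast+
  define f' where "f' = f - (\<Sum>i\<in>I. g i * M i ^ a i)"
  have f': "homog (int (d - 3)) f'"
  proof -
    have "homog (int (d - a i) - 3 + int (a i)) (g i * M i ^ a i)" if "i \<in> I" for i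
      by (intro homog_mult g hM that)
    then have "homog (int d - 3) (g i * M i ^ a i)" if "i \<in> I" for i
      using that by (force simp: I_def of_nat_diff)
    then have "homog (int d - 3) f'" unfolding f'_def by (intro homog_diff homog_sum f)
    then show ?thesis using d by (simp add: of_nat_diff)
  qed
  \<comment> \<open>A relation among all columns: the coefficients of \<open>- f'\<close> on the
    first block cancel \<open>L^3 * f'\<close>, which the reduced coefficients produce on the
    second.\<close>
  define \<kappa> where "\<kappa> = case_sum (\<lambda>\<mu>. - lookup f' \<mu>) (\<lambda>(i, cb). k i cb)"
  have "L ^ 3 * f' = (\<Sum>i\<in>I. (hpart (d - a i) (h i) - L ^ 3 * g i) * M i ^ a i)"
    unfolding f'_def right_diff_distrib Lf sum_distrib_left left_diff_distrib sum_subtractf mult.assoc ..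
  also have "\<dots> = (\<Sum>i\<in>I. \<Sum>(c, b)\<in>?S i. single 0 (k i (c, b)) * (M i ^ (d - b - c) * single (0, b, c) 1))"
  proof (intro sum.cong refl)
    fix i assume i: "i \<in> I"
    have pw: "M i ^ (d - a i - b - c) * M i ^ a i = M i ^ (d - b - c)" if "(c, b) \<in> ?S i" for c b
    proof -
      have "d - a i - b - c + a i = d - b - c" using that i by (auto simp: I_def)
      then show ?thesis by (metis power_add)
    qed
    have "(hpart (d - a i) (h i) - L ^ 3 * g i) * M i ^ a i
      = (\<Sum>(c, b)\<in>?S i. single 0 (k i (c, b)) * (M i ^ (d - a i - b - c) * single (0, b, c) 1)) * M i ^ a i"
      using hk[OF i] by simp
    also have "\<dots> = (\<Sum>(c, b)\<in>?S i. single 0 (k i (c, b)) * (M i ^ (d - b - c) * single (0, b, c) 1))"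
      unfolding sum_distrib_right
    proof (intro sum.cong refl)
      fix x assume x: "x \<in> ?S i"
      obtain c b where cb: "x = (c, b)" by (cases x)
      show "(case x of (c, b) \<Rightarrow> single 0 (k i (c, b)) * (M i ^ (d - a i - b - c) * single (0, b, c) 1)) * M i ^ a i
          = (case x of (c, b) \<Rightarrow> single 0 (k i (c, b)) * (M i ^ (d - b - c) * single (0, b, c) 1))"
      proof -
        have "single 0 (k i (c, b)) * (M i ^ (d - a i - b - c) * single (0, b, c) 1) * M i ^ a i
            = single 0 (k i (c, b)) * ((M i ^ (d - a i - b - c) * M i ^ a i) * single (0, b, c) 1)"
          by (simp only: mult_ac)
        also have "M i ^ (d - a i - b - c) * M i ^ a i = M i ^ (d - b - c)"
          by (rule pw) (use x cb in simp)
        finally show ?thesis unfolding cb prod.case .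
      qed
    qed
    finally show "(hpart (d - a i) (h i) - L ^ 3 * g i) * M i ^ a i
      = (\<Sum>(c, b)\<in>?S i. single 0 (k i (c, b)) * (M i ^ (d - b - c) * single (0, b, c) 1))" .
  qed
  also have "\<dots> = (\<Sum>x\<in>jet_index ?m I. single 0 (\<kappa> (Inr x)) * columns d L M (Inr x))"
    unfolding jet_index_def using fin by (simp add: sum.Sigma split_def \<kappa>_def columns_def)
  finally have "(\<Sum>x\<in>jet_index ?m I. single 0 (\<kappa> (Inr x)) * columns d L M (Inr x)) = L ^ 3 * f'" by simp
  moreover have "(\<Sum>\<mu>\<in>mons (d - 3). single 0 (\<kappa> (Inl \<mu>)) * columns d L M (Inl \<mu>)) = - (L ^ 3 * f')"
  proof -
    have "(\<Sum>\<mu>\<in>mons (d - 3). single 0 (\<kappa> (Inl \<mu>)) * columns d L M (Inl \<mu>))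
        = (\<Sum>\<mu>\<in>mons (d - 3). - (L ^ 3 * (single 0 (lookup f' \<mu>) * single \<mu> 1)))"
      by (intro sum.cong refl)
        (simp add: \<kappa>_def single_uminus mult.left_commute)
    also have "\<dots> = - (L ^ 3 * (\<Sum>\<mu>\<in>mons (d - 3). single 0 (lookup f' \<mu>) * single \<mu> 1))"
      by (simp only: sum_negf sum_distrib_left)
    finally show ?thesis unfolding homog_eq_sum_mons[OF f', symmetric] .
  qed
  ultimately have "(\<Sum>x\<in>?J. single 0 (\<kappa> x) * columns d L M x) = 0"
    using fin by (simp add: sum.Plus)
  then have "(\<Sum>x\<in>?J. \<kappa> x * lookup (columns d L M x) \<nu>) = 0" for \<nu>
  proof -
    have "lookup (\<Sum>x\<in>?J. single 0 (\<kappa> x) * columns d L M x) \<nu> = 0"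
      using \<open>(\<Sum>x\<in>?J. single 0 (\<kappa> x) * columns d L M x) = 0\<close> by simp
    then show ?thesis by (simp only: lookup_sum lookup_const_mult)
  qed
  then have "\<kappa> (Inl \<mu>) = 0" if "\<mu> \<in> mons (d - 3)" for \<mu>
    by (rule indep_familyD[OF indep[folded I_def]]) (use that in \<open>rule InlI\<close>)
  then have "lookup f' \<mu> = 0" if "\<mu> \<in> mons (d - 3)" for \<mu>
    using that by (simp add: \<kappa>_def)
  moreover have "lookup f' \<mu> = 0" if "\<mu> \<notin> mons (d - 3)" for \<mu>
    using homogD[OF f', of \<mu>] that by (auto simp: mons_def)
  ultimately have "lookup f' \<mu> = 0" for \<mu> by blast
  then have "f' = 0" by (intro poly_mapping_eqI) simp
  then have "f = (\<Sum>i\<in>I. g i * M i ^ a i)" by (simp add: f'_def)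
  then show "f \<in> ideal_gen s (\<lambda>i. M i ^ a i)"
    using ideal_gen_generator[of _ s _ "\<lambda>i. M i ^ a i"] by (auto simp: I_def intro!: ideal_gen_sum)
qed

section \<open>From one choice of forms to general forms\<close>

lemma general_of_witness:
  assumes "polyfun n g" "g v0 \<noteq> 0" "\<And>v. g v \<noteq> 0 \<Longrightarrow> P v"
  shows "general n P"
  using assms unfolding general_def by blast

lemma exists_square_subset:
  fixes m :: "'i \<Rightarrow> nat"
  assumes "finite I" "\<And>i. i \<in> I \<Longrightarrow> 1 \<le> m i" "(\<Sum>i\<in>I. m i - 1) + 1 \<le> d" "2 \<le> d"
    and "card (coords d) < card (jet_index m I)"
  shows "\<exists>I'\<subseteq>I. card (jet_index m I') = card (coords d)"
proof -
  define H where "H = {i \<in> I. 2 \<le> m i}"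
  have H: "finite H" "H \<subseteq> I" using assms(1) by (auto simp: H_def)
  have "card (jet_index m H) = (\<Sum>i\<in>H. 3 * (m i - 1))"
    unfolding card_jet_index[OF H(1)] by (intro sum.cong refl) (auto simp: H_def)
  also have "\<dots> = 3 * (\<Sum>i\<in>H. m i - 1)" by (simp add: sum_distrib_left)
  also have "\<dots> \<le> 3 * (\<Sum>i\<in>I. m i - 1)" using H assms(1) by (intro mult_le_mono2 sum_mono2) auto
  also have "\<dots> \<le> card (coords d)" using assms(3) card_coords[OF assms(4)] by simp
  finally have cardH: "card (jet_index m H) \<le> card (coords d)" .
  have simple: "card (jet_index m S) = card S" if "S \<subseteq> I - H" for S
  proof -
    have "m i + (m i - 1) + (m i - 2) = 1" if "i \<in> S" for i
      using that \<open>S \<subseteq> I - H\<close> assms(2)[of i] by (auto simp: H_def)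
    then show ?thesis using finite_subset[OF that] assms(1) by (simp add: card_jet_index)
  qed
  have union: "card (jet_index m (H \<union> S)) = card (jet_index m H) + card S" if "S \<subseteq> I - H" for S
  proof -
    have "finite S" using finite_subset[OF that] assms(1) by simp
    moreover have "jet_index m H \<inter> jet_index m S = {}" using that by (auto simp: jet_index_def)
    ultimately show ?thesis
      using H(1) by (simp add: jet_index_Un card_Un_disjoint simple[OF that])
  qed
  have "H \<union> (I - H) = I" using H by auto
  then have "card (coords d) - card (jet_index m H) \<le> card (I - H)"
    using union[of "I - H"] assms(5) by simp
  then obtain S where "S \<subseteq> I - H" "card S = card (coords d) - card (jet_index m H)"
    by (meson obtain_subset_with_card_n)
  then show ?thesis using union[of S] cardH H by (intro exI[of _ "H \<union> S"]) auto
qed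

theorem theorem6p2:
  fixes s p :: nat and a :: "nat \<Rightarrow> nat"
  assumes "s \<ge> 3"
    and "\<forall>i<s. a i > 0"
    and "(\<Sum>i\<in>{i. i < s \<and> a i \<le> p}. p + 1 - a i) \<le> p"
    and "\<forall>j. (\<Sum>i\<in>{i. i < s \<and> a i \<le> j}. j + 1 - a i) \<le> j \<longrightarrow> j \<le> p"
  shows "general (3 * s + 3) (\<lambda>v::nat \<Rightarrow> 'a::field_char_0.
           max_rank
             (ideal_gen s (\<lambda>i. (lin_form (v (3*i)) (v (3*i+1)) (v (3*i+2))) ^ a i))
             ((lin_form (v (3*s)) (v (3*s+1)) (v (3*s+2))) ^ 3)
             (int p - 2) (int p + 1))"
proof (cases "p \<le> 1")
  case True
  \<comment> \<open>The source degree \<open>p - 2\<close> is negative here, so the source is zero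
    and the map is injective for all forms.\<close>
  have "max_rank (ideal_gen s g) F (int p - 2) e" for g :: "nat \<Rightarrow> 'a poly3" and F e
    using True homog_neg[of "int p - 2"] ideal_genI[of "\<lambda>_. 0" g s]
    by (fastforce simp: max_rank_def mult_inj_def)
  then show ?thesis
    by (intro general_of_witness[where g = "\<lambda>_. 1" and ?v0.0 = "\<lambda>_. 0"]) (auto intro: pf_const)
next
  case False
  define d where "d = p + 1"
  have d: "3 \<le> d" "2 \<le> d" using False by (auto simp: d_def)
  have degs: "int p - 2 = int d - 3" "int p + 1 = int d" by (auto simp: d_def)
  define m where "m = (\<lambda>i. d + 1 - a i)"
  define I where "I = {i. i < s \<and> a i \<le> d}"
  have I: "finite I" "I \<subseteq> {..<s}" by (auto simp: I_def)
  have m1: "1 \<le> m i" if "i \<in> I" for i using that by (auto simp: I_def m_def)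
  have md: "m i \<le> d + 1" for i by (simp add: m_def)
  \<comment> \<open>Indices with \<open>a i = d\<close> belong to \<open>I\<close> but add
    \<open>m i - 1 = 0\<close>, so this is the sum in the definition of \<open>p\<close>.\<close>
  have "(\<Sum>i\<in>I. m i - 1) = (\<Sum>i\<in>{i. i < s \<and> a i \<le> p}. p + 1 - a i)"
    by (intro sum.mono_neutral_cong_right) (auto simp: I_def m_def d_def)
  then have sum_m: "(\<Sum>i\<in>I. m i - 1) + 1 \<le> d" using assms(3) by (simp add: d_def)
  define L where "L = (\<lambda>v::nat \<Rightarrow> 'a. lin_form (v (3*s)) (v (3*s+1)) (v (3*s+2)))"
  define M where "M = (\<lambda>(v::nat \<Rightarrow> 'a) i. lin_form (v (3*i)) (v (3*i+1)) (v (3*i+2)))"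
  have hom: "homog 1 (L v)" "homog 1 (M v i)" for v i by (simp_all add: L_def M_def homog_lin_form)

  have open_indep: "\<exists>g v0. polyfun (3 * s + 3) g \<and> g v0 \<noteq> 0 \<and> (\<forall>v. g v \<noteq> 0 \<longrightarrow>
      (\<forall>i<s. v (3*i) \<noteq> 0 \<and> v (3*s+2) * v (3*i) - v (3*s) * v (3*i+2) \<noteq> 0) \<and>
      indep_family (mons (d - 3) <+> jet_index m I') (mons d) (\<lambda>x. lookup (columns d (L v) (M v) x)))"
    if I': "I' \<subseteq> I" "card (jet_index m I') \<le> card (coords d)" for I'
  proof -
    have fin: "finite I'" using I' I finite_subset by blast
    have "(\<Sum>i\<in>I'. m i - 1) \<le> (\<Sum>i\<in>I. m i - 1)" using I I' by (intro sum_mono2) auto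
    then have "(\<Sum>i\<in>I'. m i - 1) + 1 \<le> d" using sum_m by linarith
    with exists_independent_rows[OF fin _ d(2) _ I'(2)] m1 I' obtain t u :: "nat \<Rightarrow> 'a"
      where tu: "indep_family (jet_index m I') (coords d) (\<lambda>(i, cb). jet_row (t i) (u i) cb)"
      by blast
    \<comment> \<open>The coordinates from \<open>3*s\<close> on encode \<open>L = z\<close>; below
      them each triple encodes \<open>x + t i * y + u i * z\<close>.\<close>
    define v0 where "v0 = (\<lambda>j. if j = 3*s+2 then 1 else if 3*s \<le> j then 0 else
      if j mod 3 = 0 then 1 else if j mod 3 = 1 then t (j div 3) else u (j div 3))"
    have Lv0: "L v0 = lin_form 0 0 1" by (simp add: L_def v0_def)
    have arith: "(3 * i + 1) mod 3 = 1" "(3 * i + 1) div 3 = i" "(3 * i + 2) mod 3 = 2" "(3 * i + 2) div 3 = i"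
      for i :: nat by presburger+
    have v0: "v0 (3*i) = 1" "v0 (3*i+1) = t i" "v0 (3*i+2) = u i" if "i < s" for i
      unfolding v0_def arith using that by auto
    have col_v0: "columns d (L v0) (M v0) x = columns d (lin_form 0 0 1) (\<lambda>i. lin_form 1 (t i) (u i)) x"
      if "x \<in> mons (d - 3) <+> jet_index m I'" for x
      using that I' I v0 by (auto simp: Lv0 M_def jet_index_def)
    have "indep_family (mons (d - 3) <+> jet_index m I') (mons d) (\<lambda>x. lookup (columns d (L v0) (M v0) x))"
      using columns_independent[OF d(1) fin md tu] unfolding indep_family_def
      by (simp add: col_v0 cong: sum.cong)
    moreover have "polyfun (3 * s + 3) (\<lambda>v. lookup (columns d (L v) (M v) x) \<nu>)"
      if "x \<in> mons (d - 3) <+> jet_index m I'" for x \<nu>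
    proof -
      show ?thesis
      proof (cases x)
        case (Inl \<mu>)
        then show ?thesis by (simp add: L_def polyfun_lin_form_power_mult pf_var pf_const)
      next
        case (Inr y)
        obtain i c b where y: "y = (i, c, b)" by (cases y)
        then have "i < s" using that Inr I' I by (auto simp: jet_index_def)
        then show ?thesis
          by (simp add: Inr y M_def polyfun_lin_form_power_mult pf_var pf_const)
      qed
    qed
    ultimately obtain g where g: "polyfun (3 * s + 3) g" "g v0 \<noteq> 0"
      "\<And>v. g v \<noteq> 0 \<Longrightarrow> indep_family (mons (d - 3) <+> jet_index m I') (mons d)
          (\<lambda>x. lookup (columns d (L v) (M v) x))"
      using indep_family_open[of "mons (d - 3) <+> jet_index m I'" "mons d" "3 * s + 3"
          "\<lambda>v x. lookup (columns d (L v) (M v) x)" v0] fin by auto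
    \<comment> \<open>Nonvanishing of \<open>D v i\<close> provides both hypotheses of
      \<open>homog_reducible\<close> for \<open>M v i\<close> and \<open>L v\<close>.\<close>
    define D where "D = (\<lambda>(v::nat \<Rightarrow> 'a) i. v (3*i) * (v (3*s+2) * v (3*i) - v (3*s) * v (3*i+2)))"
    have "polyfun (3 * s + 3) (\<lambda>v. \<Prod>i\<in>{..<s}. D v i)"
      unfolding D_def by (intro polyfun_prod pf_mult polyfun_diff pf_var) auto
    moreover have "D v0 i = 1" if "i < s" for i
      using v0[OF that] that by (simp add: D_def) (simp add: v0_def)
    ultimately show ?thesis
      using g
      by (intro exI[of _ "\<lambda>v. g v * (\<Prod>i\<in>{..<s}. D v i)"] exI[of _ v0]) (auto intro!: pf_mult simp: D_def)
  qed

  show ?thesis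
  \<comment> \<open>If the power columns number at most \<open>3 * d\<close>, all are kept and the
    map is injective; otherwise a subset of exactly \<open>3 * d\<close> gives surjectivity.\<close>
  proof (cases "card (jet_index m I) \<le> card (coords d)")
    case True
    from open_indep[OF subset_refl this] obtain g v0 where g: "polyfun (3 * s + 3) g" "g v0 \<noteq> 0"
      "\<And>v i. g v \<noteq> 0 \<Longrightarrow> i < s \<Longrightarrow> v (3*i) \<noteq> 0 \<and> v (3*s+2) * v (3*i) - v (3*s) * v (3*i+2) \<noteq> 0"
      "\<And>v. g v \<noteq> 0 \<Longrightarrow> indep_family (mons (d - 3) <+> jet_index m I) (mons d)
          (\<lambda>x. lookup (columns d (L v) (M v) x))"
      by blast
    have "mult_inj (ideal_gen s (\<lambda>i. M v i ^ a i)) (L v ^ 3) (int d - 3)" if v: "g v \<noteq> 0" for v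
    proof (rule mult_inj_of_columns[OF d(1) _ _ hom])
      show "indep_family (mons (d - 3) <+> jet_index (\<lambda>i. d + 1 - a i) {i. i < s \<and> a i \<le> d}) (mons d)
          (\<lambda>x. lookup (columns d (L v) (M v) x))"
        using g(4)[OF v] unfolding m_def I_def .
      show "reducible (M v i) (L v) e h" if "i < s" "homog (int e) h" for i e h
        unfolding M_def L_def using g(3)[OF v that(1)] that(2) by (intro homog_reducible) auto
    qed
    then show ?thesis
      unfolding degs by (intro general_of_witness[OF g(1,2)]) (simp add: max_rank_def M_def L_def)
  next
    case False
    then obtain I' where I': "I' \<subseteq> I" "card (jet_index m I') = card (coords d)"
      using exists_square_subset[OF I(1) m1 sum_m d(2)] by auto
    from open_indep[OF I'(1)] I'(2) obtain g v0 where g: "polyfun (3 * s + 3) g" "g v0 \<noteq> 0"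
      "\<And>v. g v \<noteq> 0 \<Longrightarrow> indep_family (mons (d - 3) <+> jet_index m I') (mons d)
          (\<lambda>x. lookup (columns d (L v) (M v) x))"
      by auto
    have "mult_surj (ideal_gen s (\<lambda>i. M v i ^ a i)) (L v ^ 3) (int d - 3) (int d)" if v: "g v \<noteq> 0" for v
      by (rule mult_surj_of_columns[OF d(1) _ _ _ hom])
        (use I' g(3)[OF v] in \<open>auto simp: I_def m_def\<close>)
    then show ?thesis
      unfolding degs by (intro general_of_witness[OF g(1,2)]) (simp add: max_rank_def M_def L_def)
  qed
qed

end
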